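(* Let $c=\log_2 e$. For integers $n>2k\ge 4$ let $f(n,k)$ denote the maximum of $\min\{|\mathcal A|,|\mathcal B|\}$ over all pairs of families $\mathcal A,\mathcal B\subset\binom{[n]}{k}$ that are disjoint ($\mathcal A\cap\mathcal B=\emptyset$) and cross-intersecting. Then: (i) If $n\ge ck^2+(2-c)k$, then $f(n,k)=\left\lfloor\frac12\binom{n-1}{k-1}\right\rfloor$. (ii) If $n\le ck^2-2ck+1$, then $f(n,k)\neq\left\lfloor\frac12\binom{n-1}{k-1}\right\rfloor$.
   Context: $[n]=\{1,\dots,n\}$ and $\binom{[n]}{k}$ is the collection of all $k$-element subsets of $[n]$. Two families $\mathcal A,\mathcal B$ of sets are cross-intersecting if $A\cap B\neq\emptyset$ for all $A\in\mathcal A$, $B\in\mathcal B$. *)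

theory Defs
  imports Complex_Main
begin

definition cross_intersecting :: "'a set set \<Rightarrow> 'a set set \<Rightarrow> bool" where
  "cross_intersecting A B \<longleftrightarrow> (\<forall>X\<in>A. \<forall>Y\<in>B. X \<inter> Y \<noteq> {})"

definition f_ci :: "nat \<Rightarrow> nat \<Rightarrow> nat" where
  "f_ci n k = Max {min (card A) (card B) | A B.
      A \<subseteq> {X. X \<subseteq> {1..n} \<and> card X = k} \<and> B \<subseteq> {X. X \<subseteq> {1..n} \<and> card X = k}
      \<and> A \<inter> B = {} \<and> cross_intersecting A B}"

end

theory Submission
  imports Defs
begin

text \<open>
  Put N = C(n-1, k-1) and M = C(n-k-1, k-1), the number of k-sets through a point x missing a
  fixed k-set that avoids x. The bound n \<ge> ck(k-1) + 2k gives 2M \<ge> N + 2.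

  Upper bound. Suppose both families have more than N/2 members. If all members of one contain a
  point x, then so do all members of the other, because a member avoiding x would leave at most
  N - M < N/2 sets in the first; disjointness is then contradicted. So neither family is a star.
  Among all such cross-intersecting pairs of non-stars, disjoint or not, take one that
  minimises the sum of all elements of all members. Either some shift i <- j turns a family,
  and hence by the previous argument both, into a star at i; then every member meets {i, j}, and the
  Hilton--Milner bound for non-empty cross-intersecting families, applied to the links of i and j,
  gives |A| + |B| \<le> 2(N - M + 1). Or both families are shifted. If every member
  meets {1, 2} the same bound applies. Otherwise some member misses {1..s}, with s \<ge> 2 maximal, and
  then every member of the other family has more than s elements in {1..k+s}; counting such sets
  gives about (s+1) (ln 2)^s / s! N, and the case s = 2 is refined once more.

  Lower bound violation. With D = {2..k}, put more than N/2 of the sets that contain 1 and meet D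
  into A, and the other sets containing 1 together with two supersets of D into B. This is possible
  once 2 C(n-k, k-1) < N.
\<close>

subsection \<open>Uniform families and shifting\<close>

definition ksets :: "'a set \<Rightarrow> nat \<Rightarrow> 'a set set" where
  "ksets X k = {F. F \<subseteq> X \<and> card F = k}"

lemma card_ksets: "finite X \<Longrightarrow> card (ksets X k) = card X choose k"
  by (simp add: ksets_def n_subsets)

lemma finite_ksets: "finite X \<Longrightarrow> finite (ksets X k)"
  by (rule finite_subset[of _ "Pow X"]) (auto simp: ksets_def)

lemma ksets_finite_mem: "finite X \<Longrightarrow> F \<in> ksets X k \<Longrightarrow> finite F"
  by (auto simp: ksets_def intro: finite_subset)

lemma cross_intersectingD:
  "cross_intersecting A B \<Longrightarrow> X \<in> A \<Longrightarrow> Y \<in> B \<Longrightarrow> X \<inter> Y \<noteq> {}"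
  by (auto simp: cross_intersecting_def)

lemma cross_intersecting_commute: "cross_intersecting A B \<longleftrightarrow> cross_intersecting B A"
  by (auto simp: cross_intersecting_def Int_commute)

text \<open>The Erdos--Ko--Rado compression from \<open>j\<close> to \<open>i\<close>. A set stays
  put when its image already belongs to \<open>A\<close>; this makes the map injective on
  \<open>A\<close>, so \<open>shift\<close> preserves the size of a family.\<close>

definition shift_set :: "'a \<Rightarrow> 'a \<Rightarrow> 'a set set \<Rightarrow> 'a set \<Rightarrow> 'a set" where
  "shift_set i j A F =
     (if j \<in> F \<and> i \<notin> F \<and> insert i (F - {j}) \<notin> A then insert i (F - {j}) else F)"

definition shift :: "'a \<Rightarrow> 'a \<Rightarrow> 'a set set \<Rightarrow> 'a set set" where
  "shift i j A = shift_set i j A ` A"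

lemma inj_on_shift_set: "inj_on (shift_set i j A) A"
proof (rule inj_onI)
  fix F G assume FG: "F \<in> A" "G \<in> A" and eq: "shift_set i j A F = shift_set i j A G"
  have *: "insert i (F - {j}) = insert i (G - {j}) \<Longrightarrow> j \<in> F \<Longrightarrow> i \<notin> F \<Longrightarrow> j \<in> G \<Longrightarrow> i \<notin> G \<Longrightarrow> F = G"
    by (metis Diff_insert_absorb insert_Diff insert_iff Diff_iff)
  show "F = G"
    using eq FG * unfolding shift_set_def by (auto split: if_splits)
qed

lemma card_shift: "card (shift i j A) = card A"
  unfolding shift_def by (rule card_image) (rule inj_on_shift_set)

lemma shift_subset_ksets:
  assumes "finite X" "i \<in> X" "A \<subseteq> ksets X k"
  shows "shift i j A \<subseteq> ksets X k"
proof
  fix H assume "H \<in> shift i j A"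
  then obtain F where F: "F \<in> A" "H = shift_set i j A F" by (auto simp: shift_def)
  have k: "F \<in> ksets X k" using F assms by auto
  have fin: "finite F" using k assms ksets_finite_mem by blast
  have "card (insert i (F - {j})) = card F" if "j \<in> F" "i \<notin> F"
    using that fin card_Suc_Diff1[of F j] by simp
  then have "insert i (F - {j}) \<in> ksets X k" if "j \<in> F" "i \<notin> F"
    using that k assms(2) by (auto simp: ksets_def)
  then show "H \<in> ksets X k" using k F(2) unfolding shift_set_def by simp
qed

text \<open>The second fact of case \<open>old\<close> records why a set that could have moved did
  not: its image was already present. Preservation of cross-intersection rests on it.\<close>

lemma shift_cases:
  assumes "H \<in> shift i j A"
  obtains (old) "H \<in> A" "j \<in> H \<Longrightarrow> i \<notin> H \<Longrightarrow> insert i (H - {j}) \<in> A"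
    | (new) F where "F \<in> A" "j \<in> F" "i \<notin> F" "H = insert i (F - {j})"
  using assms unfolding shift_def shift_set_def by (auto split: if_splits)

text \<open>Two unmoved sets are original members, and two moved sets share \<open>i\<close>. If a
  moved \<open>X\<close>, coming from \<open>F\<close>, missed an unmoved \<open>Y\<close>, then
  \<open>F\<close> and \<open>Y\<close> would meet in \<open>j\<close> alone; so \<open>Y\<close>
  was blocked, and \<open>insert i (Y - {j})\<close> in \<open>B\<close> would miss
  \<open>F\<close>.\<close>

lemma cross_intersecting_shift:
  assumes ci: "cross_intersecting A B"
  shows "cross_intersecting (shift i j A) (shift i j B)"
proof -
  have mixed: "X \<inter> Y \<noteq> {}"
    if ci: "cross_intersecting A B" and F: "F \<in> A" "j \<in> F" "i \<notin> F" "X = insert i (F - {j})"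
      and Y: "Y \<in> B" "j \<in> Y \<Longrightarrow> i \<notin> Y \<Longrightarrow> insert i (Y - {j}) \<in> B" for A B F X Y
  proof
    assume dis: "X \<inter> Y = {}"
    have iY: "i \<notin> Y" and sub: "F \<inter> Y \<subseteq> {j}" using dis F by auto
    have "F \<inter> Y \<noteq> {}" using cross_intersectingD[OF ci F(1) Y(1)] .
    then have "j \<in> Y" using sub by auto
    then have "insert i (Y - {j}) \<in> B" using Y(2) iY by auto
    from cross_intersectingD[OF ci F(1) this] show False using sub F(3) by auto
  qed
  show ?thesis unfolding cross_intersecting_def
  proof (intro ballI)
    fix X Y assume X: "X \<in> shift i j A" and Y: "Y \<in> shift i j B"
    from X show "X \<inter> Y \<noteq> {}"
    proof (cases rule: shift_cases)
      case old
      note Xo = this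
      from Y show ?thesis
      proof (cases rule: shift_cases)
        case old then show ?thesis using Xo ci cross_intersectingD by blast
      next
        case (new G)
        show ?thesis
          using mixed[of B A G Y X] ci new Xo by (metis Int_commute cross_intersecting_commute)
      qed
    next
      case (new F)
      note Xn = this
      from Y show ?thesis
      proof (cases rule: shift_cases)
        case old then show ?thesis using mixed[OF ci Xn] by blast
      next
        case (new G) then show ?thesis using Xn by auto
      qed
    qed
  qed
qed

text \<open>A potential for extremal choices: in a class of families closed under such shifts, one
  of least total weight is fixed by all of them. Applied below with the indicator of a point and
  with the identity as weight.\<close>

lemma weight_shift:
  fixes w :: "'a \<Rightarrow> nat"
  assumes "finite A" "\<And>F. F \<in> A \<Longrightarrow> finite F" "w i < w j"
  shows weight_shift_le: "(\<Sum>F\<in>shift i j A. sum w F) \<le> (\<Sum>F\<in>A. sum w F)"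
    and weight_shift_less: "shift i j A \<noteq> A \<Longrightarrow> (\<Sum>F\<in>shift i j A. sum w F) < (\<Sum>F\<in>A. sum w F)"
proof -
  have eq: "(\<Sum>F\<in>shift i j A. sum w F) = (\<Sum>F\<in>A. sum w (shift_set i j A F))"
    unfolding shift_def by (simp add: sum.reindex[OF inj_on_shift_set])
  have lt: "sum w (insert i (F - {j})) < sum w F" if "F \<in> A" "j \<in> F" "i \<notin> F" for F
  proof -
    have f: "finite F" using that assms by blast
    have "sum w (insert i (F - {j})) = w i + sum w (F - {j})" using f that by simp
    also have "\<dots> < w j + sum w (F - {j})" using assms by simp
    also have "\<dots> = sum w F" using f that by (simp add: sum.remove)
    finally show ?thesis .
  qed
  have le: "\<forall>F\<in>A. sum w (shift_set i j A F) \<le> sum w F"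
    using lt unfolding shift_set_def by (auto intro: less_imp_le)
  show "(\<Sum>F\<in>shift i j A. sum w F) \<le> (\<Sum>F\<in>A. sum w F)"
    unfolding eq by (rule sum_mono) (use le in blast)
  assume ne: "shift i j A \<noteq> A"
  have "\<exists>F\<in>A. shift_set i j A F \<noteq> F"
  proof (rule ccontr)
    assume "\<not> ?thesis"
    then have "shift i j A = A" unfolding shift_def by auto
    with ne show False by simp
  qed
  then obtain F where F: "F \<in> A" "shift_set i j A F \<noteq> F" by blast
  then have "sum w (shift_set i j A F) < sum w F"
    using lt unfolding shift_set_def by (auto split: if_splits)
  then show "(\<Sum>F\<in>shift i j A. sum w F) < (\<Sum>F\<in>A. sum w F)"
    unfolding eq using sum_strict_mono_ex1[OF assms(1) le] F(1) by blast
qed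

lemma shift_fixedD:
  assumes "shift i j A = A" "F \<in> A" "j \<in> F" "i \<notin> F"
  shows "insert i (F - {j}) \<in> A"
proof (rule ccontr)
  assume "insert i (F - {j}) \<notin> A"
  then have "shift_set i j A F = insert i (F - {j})" using assms by (simp add: shift_set_def)
  then have "insert i (F - {j}) \<in> shift i j A" using assms(2) unfolding shift_def by (metis imageI)
  with assms \<open>insert i (F - {j}) \<notin> A\<close> show False by simp
qed

section \<open>Counting uniform families and links\<close>

lemma card_ksets_superset:
  assumes "finite X" "T \<subseteq> X"
  shows "card {F \<in> ksets X (card T + l). T \<subseteq> F} = (card X - card T) choose l"
proof -
  have finT: "finite T" using assms finite_subset by blast
  have "bij_betw (\<lambda>G. T \<union> G) (ksets (X - T) l) {F \<in> ksets X (card T + l). T \<subseteq> F}"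
  proof (rule bij_betw_byWitness[where f' = "\<lambda>F. F - T"])
    show "(\<lambda>G. T \<union> G) ` ksets (X - T) l \<subseteq> {F \<in> ksets X (card T + l). T \<subseteq> F}"
    proof (rule image_subsetI)
      fix G assume G: "G \<in> ksets (X - T) l"
      then have "finite G" using assms(1) ksets_finite_mem by blast
      then have "card (T \<union> G) = card T + card G"
        using finT G by (intro card_Un_disjoint) (auto simp: ksets_def)
      then show "T \<union> G \<in> {F \<in> ksets X (card T + l). T \<subseteq> F}"
        using G assms(2) by (auto simp: ksets_def)
    qed
    show "(\<lambda>F. F - T) ` {F \<in> ksets X (card T + l). T \<subseteq> F} \<subseteq> ksets (X - T) l"
      using finT by (auto simp: ksets_def card_Diff_subset)
  qed (auto simp: ksets_def)
  then have "card {F \<in> ksets X (card T + l). T \<subseteq> F} = card (ksets (X - T) l)"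
    using bij_betw_same_card by metis
  then show ?thesis using assms finT by (simp add: card_ksets card_Diff_subset)
qed

lemma card_ksets_meeting:
  assumes "finite X" "D \<subseteq> X"
  shows "card {F \<in> ksets X l. F \<inter> D \<noteq> {}} + (card X - card D choose l) = card X choose l"
proof -
  have "ksets X l = {F \<in> ksets X l. F \<inter> D \<noteq> {}} \<union> ksets (X - D) l"
    by (auto simp: ksets_def)
  moreover have "{F \<in> ksets X l. F \<inter> D \<noteq> {}} \<inter> ksets (X - D) l = {}" by (auto simp: ksets_def)
  ultimately have "card (ksets X l) = card {F \<in> ksets X l. F \<inter> D \<noteq> {}} + card (ksets (X - D) l)"
    using finite_ksets[OF assms(1)] by (metis card_Un_disjoint finite_Un)
  then show ?thesis using assms by (simp add: card_ksets card_Diff_subset finite_subset)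
qed

definition link :: "'a \<Rightarrow> 'a set set \<Rightarrow> 'a set set" where
  "link x A = (\<lambda>F. F - {x}) ` {F \<in> A. x \<in> F}"

lemma card_link: "card (link x A) = card {F \<in> A. x \<in> F}"
  unfolding link_def by (rule card_image, rule inj_onI) (metis (no_types, lifting) insert_Diff mem_Collect_eq)

lemma link_subset_ksets:
  assumes "A \<subseteq> ksets X (Suc l)"
  shows "link x A \<subseteq> ksets (X - {x}) l"
  using assms unfolding link_def ksets_def by (auto simp: card_Diff_singleton)

lemma card_split_mem:
  assumes "finite A"
  shows "card A = card {F \<in> A. x \<notin> F} + card (link x A)"
proof -
  have "A = {F \<in> A. x \<notin> F} \<union> {F \<in> A. x \<in> F}" by auto
  then have "card A = card ({F \<in> A. x \<notin> F} \<union> {F \<in> A. x \<in> F})" by simp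
  also have "\<dots> = card {F \<in> A. x \<notin> F} + card {F \<in> A. x \<in> F}"
    using assms by (intro card_Un_disjoint) auto
  finally show ?thesis by (simp add: card_link)
qed

section \<open>The Hilton--Milner bound for two families\<close>

lemma ex_shifted_towards:
  assumes "finite X" "x \<in> X" "P \<subseteq> ksets X l" "Q \<subseteq> ksets X l" "cross_intersecting P Q"
  obtains P' Q' where "P' \<subseteq> ksets X l" "Q' \<subseteq> ksets X l" "cross_intersecting P' Q'"
    "card P' = card P" "card Q' = card Q"
    "\<And>i F. i \<in> X \<Longrightarrow> F \<in> P' \<Longrightarrow> x \<in> F \<Longrightarrow> i \<notin> F \<Longrightarrow> insert i (F - {x}) \<in> P'"
    "\<And>i F. i \<in> X \<Longrightarrow> F \<in> Q' \<Longrightarrow> x \<in> F \<Longrightarrow> i \<notin> F \<Longrightarrow> insert i (F - {x}) \<in> Q'"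
proof -
  \<comment> \<open>With this weight \<open>W\<close> counts the members containing
    \<open>x\<close>. The chosen pair has the fewest of them, so every shift that replaces
    \<open>x\<close> by another point leaves both families fixed.\<close>
  define w :: "'a \<Rightarrow> nat" where "w = (\<lambda>y. if y = x then 1 else 0)"
  define W where "W = (\<lambda>P. \<Sum>F\<in>P. sum w F)"
  define C where "C = (\<lambda>(R, S). R \<subseteq> ksets X l \<and> S \<subseteq> ksets X l \<and> cross_intersecting R S
     \<and> card R = card P \<and> card S = card Q)"
  have "C (P, Q)" using assms by (simp add: C_def)
  then obtain R S where RS: "C (R, S)" and least: "\<And>R' S'. C (R', S') \<Longrightarrow> W R + W S \<le> W R' + W S'"
    using ex_has_least_nat[of C _ "\<lambda>(R, S). W R + W S"] by force
  have sub: "R \<subseteq> ksets X l" "S \<subseteq> ksets X l" and ci: "cross_intersecting R S"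
    and cd: "card R = card P" "card S = card Q"
    using RS by (auto simp: C_def)
  have fin: "finite R" "finite S" "\<And>F. F \<in> R \<Longrightarrow> finite F" "\<And>F. F \<in> S \<Longrightarrow> finite F"
    using sub finite_ksets[OF assms(1)] ksets_finite_mem[OF assms(1)] by (auto intro: finite_subset)
  have fixed: "shift i x R = R \<and> shift i x S = S" if "i \<in> X" "i \<noteq> x" for i
  proof (rule ccontr)
    assume ne: "\<not> ?thesis"
    have lt: "w i < w x" using that by (simp add: w_def)
    have "C (shift i x R, shift i x S)"
      unfolding C_def using sub ci cd that assms(1)
      by (simp add: shift_subset_ksets cross_intersecting_shift card_shift)
    from least[OF this] have "W R + W S \<le> W (shift i x R) + W (shift i x S)" .
    moreover have "W (shift i x R) \<le> W R" "W (shift i x S) \<le> W S"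
      unfolding W_def using weight_shift_le[of R w i x] weight_shift_le[of S w i x] fin lt by auto
    moreover have "W (shift i x R) < W R \<or> W (shift i x S) < W S"
      unfolding W_def using weight_shift_less[of R w i x] weight_shift_less[of S w i x] fin lt ne by auto
    ultimately show False by linarith
  qed
  have cl: "insert i (F - {x}) \<in> R" if "i \<in> X" "F \<in> R" "x \<in> F" "i \<notin> F" for i F
    using shift_fixedD[of i x R F] fixed[of i] that by auto
  have cl2: "insert i (F - {x}) \<in> S" if "i \<in> X" "F \<in> S" "x \<in> F" "i \<notin> F" for i F
    using shift_fixedD[of i x S F] fixed[of i] that by auto
  show ?thesis by (rule that[OF sub ci cd]) (use cl cl2 in blast)+
qed

text \<open>Complementation in \<open>X\<close> sends \<open>l\<close>-sets to
  \<open>l\<close>-sets, and the complement of a member of \<open>Q\<close> cannot lie in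
  \<open>P\<close>, since it misses that member.\<close>

lemma cross_intersecting_card_sum_half:
  assumes "finite X" "card X = 2 * l" "P \<subseteq> ksets X l" "Q \<subseteq> ksets X l" "cross_intersecting P Q"
  shows "card P + card Q \<le> card X choose l"
proof -
  define Q' where "Q' = (\<lambda>F. X - F) ` Q"
  have inj: "inj_on (\<lambda>F. X - F) Q"
    by (rule inj_onI) (use assms(4) in \<open>auto simp: ksets_def\<close>)
  have "Q' \<subseteq> ksets X l"
    using assms unfolding Q'_def ksets_def by (auto simp: card_Diff_subset finite_subset)
  moreover have "P \<inter> Q' = {}"
    using cross_intersectingD[OF assms(5)] unfolding Q'_def by auto
  ultimately have "card (P \<union> Q') = card P + card Q'" "card (P \<union> Q') \<le> card (ksets X l)"
    using assms finite_ksets[OF assms(1)]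
    by (meson card_Un_disjoint finite_subset, meson Un_least card_mono)
  then show ?thesis using card_image[OF inj] card_ksets[OF assms(1)] by (simp add: Q'_def)
qed

text \<open>Equality holds when \<open>P\<close> is one set and \<open>Q\<close> consists of all
  \<open>l\<close>-sets meeting it. Induction on \<open>card X\<close>: complementation settles
  \<open>card X = 2 * l\<close>. Otherwise both families are first pushed away from a point
  \<open>x\<close>, then split into members avoiding \<open>x\<close> and links at \<open>x\<close>,
  and Pascal's rule adds the two bounds.\<close>

theorem hilton_milner_cross:
  assumes "finite X" "P \<subseteq> ksets X l" "Q \<subseteq> ksets X l" "P \<noteq> {}" "Q \<noteq> {}"
    "cross_intersecting P Q" "1 \<le> l" "2 * l \<le> card X"
  shows "card P + card Q + (card X - l choose l) \<le> (card X choose l) + 1"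
  using assms
proof (induction "card X" arbitrary: X P Q l rule: less_induct)
  case less
  note finX = \<open>finite X\<close>
  show ?case
  proof (cases "card X = 2 * l")
    case True
    then show ?thesis using cross_intersecting_card_sum_half[OF finX True less.prems(2,3,6)] by simp
  next
    case False
    then have big: "2 * l < card X" using less.prems by simp
    obtain r where l: "l = Suc r" using less.prems(7) by (cases l) auto
    obtain x where x: "x \<in> X" using big by fastforce
    obtain P' Q' where PQ: "P' \<subseteq> ksets X l" "Q' \<subseteq> ksets X l" "cross_intersecting P' Q'"
      and cd: "card P' = card P" "card Q' = card Q"
      and cP: "\<And>i F. i \<in> X \<Longrightarrow> F \<in> P' \<Longrightarrow> x \<in> F \<Longrightarrow> i \<notin> F \<Longrightarrow> insert i (F - {x}) \<in> P'"
      and cQ: "\<And>i F. i \<in> X \<Longrightarrow> F \<in> Q' \<Longrightarrow> x \<in> F \<Longrightarrow> i \<notin> F \<Longrightarrow> insert i (F - {x}) \<in> Q'"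
      by (rule ex_shifted_towards[OF finX x less.prems(2,3,6)]) blast
    define Y where "Y = X - {x}"
    have Y: "finite Y" "card Y = card X - 1" "card Y < card X"
      using finX x big by (auto simp: Y_def)
    have finP: "finite P'" "finite Q'"
      using PQ finite_ksets[OF finX] by (auto intro: finite_subset)
    have ne: "P' \<noteq> {}" "Q' \<noteq> {}"
      using cd less.prems finite_ksets[OF finX] by (metis card_0_eq card.empty finite_subset)+
    define P0 where "P0 = {F \<in> P'. x \<notin> F}"
    define Q0 where "Q0 = {F \<in> Q'. x \<notin> F}"
    \<comment> \<open>Both parts avoiding \<open>x\<close> must be non-empty for the induction
      hypothesis. A member through \<open>x\<close> omits some point \<open>i\<close>, because
      \<open>l < card X\<close>, and exchanging \<open>x\<close> for \<open>i\<close> stays in the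
      family.\<close>
    have escape: "{F \<in> R. x \<notin> F} \<noteq> {}"
      if R: "R \<noteq> {}" "R \<subseteq> ksets X l"
        and c: "\<And>i F. i \<in> X \<Longrightarrow> F \<in> R \<Longrightarrow> x \<in> F \<Longrightarrow> i \<notin> F \<Longrightarrow> insert i (F - {x}) \<in> R" for R
    proof -
      obtain F where F: "F \<in> R" using R by auto
      have "F \<subseteq> X" "card F < card X" using F R big by (auto simp: ksets_def)
      then obtain i where "i \<in> X" "i \<notin> F" by (metis less_irrefl subsetI subset_antisym)
      then show ?thesis using c[of i F] F x by (cases "x \<in> F") auto
    qed
    have ne0: "P0 \<noteq> {}" "Q0 \<noteq> {}"
      unfolding P0_def Q0_def using escape ne PQ cP cQ by blast+
    have sub0: "P0 \<subseteq> ksets Y l" "Q0 \<subseteq> ksets Y l"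
      using PQ by (auto simp: P0_def Q0_def Y_def ksets_def)
    have ci0: "cross_intersecting P0 Q0"
      using PQ(3) by (auto simp: cross_intersecting_def P0_def Q0_def)
    have ih0: "card P0 + card Q0 + (card Y - l choose l) \<le> (card Y choose l) + 1"
      using less.hyps[OF Y(3,1) sub0 ne0 ci0] less.prems(7) big Y(2) by linarith
    have sub1: "link x P' \<subseteq> ksets Y r" "link x Q' \<subseteq> ksets Y r"
      using link_subset_ksets PQ l unfolding Y_def by metis+
    \<comment> \<open>If \<open>F\<close> and \<open>G\<close> met only in \<open>x\<close>, some
      \<open>i\<close> would lie outside both, since their union has at most
      \<open>2 * l < card X\<close> points; exchanging \<open>x\<close> for \<open>i\<close> in
      \<open>F\<close> would give a member of \<open>P'\<close> disjoint from
      \<open>G\<close>.\<close>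
    have ci1: "cross_intersecting (link x P') (link x Q')"
      unfolding cross_intersecting_def
    proof (intro ballI notI)
      fix F' G' assume FG: "F' \<in> link x P'" "G' \<in> link x Q'" and dis: "F' \<inter> G' = {}"
      obtain F G where F: "F \<in> P'" "x \<in> F" "F' = F - {x}" and G: "G \<in> Q'" "x \<in> G" "G' = G - {x}"
        using FG by (auto simp: link_def)
      have "card F = l" "card G = l" using F(1) G(1) PQ(1,2) by (auto simp: ksets_def)
      then have "card (F \<union> G) \<le> l + l" using card_Un_le[of F G] by simp
      then have "card (F \<union> G) < card X" using big by linarith
      moreover have "F \<union> G \<subseteq> X" using F G PQ by (auto simp: ksets_def)
      ultimately obtain i where i: "i \<in> X" "i \<notin> F" "i \<notin> G"
        by (metis UnI1 UnI2 less_irrefl subsetI subset_antisym)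
      have "insert i (F - {x}) \<in> P'" using cP i F by blast
      from cross_intersectingD[OF PQ(3) this G(1)] show False using dis F G i by auto
    qed
    have total: "card P + card Q = card P0 + card Q0 + (card (link x P') + card (link x Q'))"
      using card_split_mem[OF finP(1), of x] card_split_mem[OF finP(2), of x] cd
      by (simp add: P0_def Q0_def)
    have pas1: "card X choose l = (card Y choose l) + (card Y choose r)"
      using Y(2) big l by (cases "card X") auto
    have pas2: "card X - l choose l = (card Y - l choose l) + (card Y - l choose r)"
    proof -
      have "card X - l = Suc (card Y - l)" using Y(2) big by linarith
      then show ?thesis unfolding l by simp
    qed
    have one_empty: "card R + (card Y - l choose r) \<le> (card Y choose r)"
      if "D \<in> ksets Y l" "R \<subseteq> ksets Y r" "\<And>F. F \<in> R \<Longrightarrow> F \<inter> D \<noteq> {}" for D R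
    proof -
      have "card R \<le> card {F \<in> ksets Y r. F \<inter> D \<noteq> {}}"
        by (rule card_mono) (use that finite_ksets[OF Y(1)] in auto)
      then show ?thesis using card_ksets_meeting[OF Y(1), of D r] that(1) by (auto simp: ksets_def)
    qed
    \<comment> \<open>The link part must do without the \<open>+ 1\<close>, which \<open>ih0\<close>
      already spends. If one link is empty, the other consists of \<open>r\<close>-sets meeting a
      fixed \<open>l\<close>-set. Otherwise the induction hypothesis for \<open>r\<close> loses one,
      and the Pascal term \<open>card Y - l choose r'\<close> repays it.\<close>
    have key: "card (link x P') + card (link x Q') + (card Y - l choose r) \<le> (card Y choose r)"
    proof (cases "link x P' = {} \<or> link x Q' = {}")
      case True
      obtain D E where D: "D \<in> P0" and E: "E \<in> Q0" using ne0 by blast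
      have QD: "F \<inter> D \<noteq> {}" if "F \<in> link x Q'" for F
        using that D cross_intersectingD[OF PQ(3)] unfolding link_def P0_def by fastforce
      have PE: "F \<inter> E \<noteq> {}" if "F \<in> link x P'" for F
        using that E cross_intersectingD[OF PQ(3)] unfolding link_def Q0_def by fastforce
      have "card (link x Q') + (card Y - l choose r) \<le> (card Y choose r)"
        using one_empty[of D "link x Q'"] QD D sub0 sub1 by blast
      moreover have "card (link x P') + (card Y - l choose r) \<le> (card Y choose r)"
        using one_empty[of E "link x P'"] PE E sub0 sub1 by blast
      ultimately show ?thesis using True by auto
    next
      case False
      then have r1: "1 \<le> r"
      proof -
        obtain F G where FG: "F \<in> link x P'" "G \<in> link x Q'" using False by blast
        have "F \<noteq> {}" using cross_intersectingD[OF ci1 FG] by auto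
        moreover have "F \<in> ksets Y r" using FG sub1 by auto
        moreover from this have "finite F" by (rule ksets_finite_mem[OF Y(1)])
        ultimately have "0 < card F" "card F = r" by (auto simp: ksets_def card_gt_0_iff)
        then show ?thesis by simp
      qed
      then obtain r' where r': "r = Suc r'" by (cases r) auto
      have ih: "card (link x P') + card (link x Q') + (card Y - r choose r) \<le> (card Y choose r) + 1"
      proof (rule less.hyps[OF Y(3,1) sub1 _ _ ci1 r1])
        show "2 * r \<le> card Y" using big Y(2) l by simp
      qed (use False in auto)
      have "card Y - r = Suc (card Y - l)" using l big Y(2) by linarith
      then have "card Y - r choose r = (card Y - l choose r') + (card Y - l choose r)"
        using r' by simp
      moreover have "card Y - l choose r' \<ge> 1"
        using l r' big Y(2) by (simp add: Suc_le_eq)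
      ultimately show ?thesis using ih by linarith
    qed
    show ?thesis using total pas1 pas2 key ih0 by linarith
  qed
qed

section \<open>Bounds for families with a small cover\<close>

lemma card_covered_le:
  assumes X: "finite X" and B: "B \<subseteq> ksets X k" and T: "finite TT" "TT \<subseteq> ksets X t" and "t \<le> k"
    and cov: "\<And>F. F \<in> B \<Longrightarrow> \<exists>T\<in>TT. T \<subseteq> F"
  shows "card B \<le> card TT * ((card X - t) choose (k - t))"
proof -
  have "B \<subseteq> (\<Union>T\<in>TT. {F \<in> ksets X k. T \<subseteq> F})" using B cov by auto
  then have "card B \<le> card (\<Union>T\<in>TT. {F \<in> ksets X k. T \<subseteq> F})"
    using T finite_ksets[OF X] by (intro card_mono) auto
  also have "\<dots> \<le> (\<Sum>T\<in>TT. card {F \<in> ksets X k. T \<subseteq> F})" by (rule card_UN_le[OF T(1)])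
  also have "\<dots> = (\<Sum>T\<in>TT. (card X - t) choose (k - t))"
  proof (rule sum.cong[OF refl])
    fix T' assume "T' \<in> TT"
    then have "T' \<subseteq> X" "card T' = t" using T(2) by (auto simp: ksets_def)
    then show "card {F \<in> ksets X k. T' \<subseteq> F} = (card X - t) choose (k - t)"
      using card_ksets_superset[OF X, of T' "k - t"] \<open>t \<le> k\<close> by simp
  qed
  finally show ?thesis by simp
qed

text \<open>The links at \<open>x\<close> are \<open>r\<close>-subsets of \<open>X - {x}\<close>
  that have to meet \<open>D\<close>; the subtracted binomial counts those missing it. In use,
  \<open>D\<close> is a member of the other family avoiding \<open>x\<close>.\<close>

lemma star_meeting_bound:
  assumes X: "finite X" "x \<in> X" and A: "A \<subseteq> ksets X (Suc r)" "\<And>F. F \<in> A \<Longrightarrow> x \<in> F"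
    and D: "D \<in> ksets X k" "x \<notin> D" "\<And>F. F \<in> A \<Longrightarrow> F \<inter> D \<noteq> {}"
  shows "card A + ((card X - 1 - k) choose r) \<le> (card X - 1) choose r"
proof -
  have "card A = card (link x A)"
  proof -
    have "{F \<in> A. x \<in> F} = A" using A(2) by auto
    then show ?thesis by (simp add: card_link)
  qed
  moreover have "card (link x A) \<le> card {F \<in> ksets (X - {x}) r. F \<inter> D \<noteq> {}}"
  proof (rule card_mono)
    show "link x A \<subseteq> {F \<in> ksets (X - {x}) r. F \<inter> D \<noteq> {}}"
      using link_subset_ksets[OF A(1), of x] D(2,3) unfolding link_def by blast
    show "finite {F \<in> ksets (X - {x}) r. F \<inter> D \<noteq> {}}" using finite_ksets[of "X - {x}"] X(1) by simp
  qed
  moreover have "D \<subseteq> X - {x}" "card D = k" using D(1,2) by (auto simp: ksets_def)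
  ultimately show ?thesis using card_ksets_meeting[of "X - {x}" D r] X by simp
qed

text \<open>A member of \<open>A\<close> with \<open>i\<close> but not \<open>j\<close> and a member
  of \<open>B\<close> with \<open>j\<close> but not \<open>i\<close> meet outside
  \<open>{i, j}\<close>. So their links are cross-intersecting, and non-empty by
  \<open>nontriv\<close>. The Hilton--Milner bound is applied to this pair and to the pair with
  \<open>i\<close> and \<open>j\<close> exchanged; Pascal's rule absorbs the members containing both
  points.\<close>

lemma two_cover_bound:
  fixes X :: "'a set"
  assumes X: "finite X" "2 * k \<le> card X" "2 \<le> k"
    and sub: "A \<subseteq> ksets X k" "B \<subseteq> ksets X k" and ci: "cross_intersecting A B"
    and ij: "i \<in> X" "j \<in> X" "i \<noteq> j"
    and cov: "\<And>F. F \<in> A \<union> B \<Longrightarrow> i \<in> F \<or> j \<in> F"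
    and nontriv: "\<exists>F\<in>A. i \<notin> F" "\<exists>F\<in>A. j \<notin> F" "\<exists>F\<in>B. i \<notin> F" "\<exists>F\<in>B. j \<notin> F"
  shows "card A + card B + 2 * ((card X - k - 1) choose (k - 1)) \<le> 2 * ((card X - 1) choose (k - 1)) + 2"
proof -
  obtain r where k: "k = Suc (Suc r)" using X(3) by (metis Suc_le_D numeral_2_eq_2 le_SucE nat.inject not0_implies_Suc)
  define Y where "Y = X - {i, j}"
  define L where "L = (\<lambda>(a :: 'a) b C. link a {F \<in> C. b \<notin> F})"
  have Y: "finite Y" "card Y = card X - 2" using X ij by (auto simp: Y_def card_Diff_subset numeral_2_eq_2)
  have Lsub: "L i j C \<subseteq> ksets Y (Suc r)" "L j i C \<subseteq> ksets Y (Suc r)" if "C \<subseteq> ksets X k" for C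
  proof -
    have "link a {F \<in> C. b \<notin> F} \<subseteq> ksets (X - {b} - {a}) (Suc r)" for a b
      by (rule link_subset_ksets) (use that k in \<open>auto simp: ksets_def\<close>)
    moreover have "X - {j} - {i} = Y" "X - {i} - {j} = Y" by (auto simp: Y_def)
    ultimately show "L i j C \<subseteq> ksets Y (Suc r)" "L j i C \<subseteq> ksets Y (Suc r)"
      unfolding L_def by metis+
  qed
  have Lci: "cross_intersecting (L a b A) (L b a B)" for a b
    unfolding cross_intersecting_def
  proof (intro ballI)
    fix F' G' assume "F' \<in> L a b A" "G' \<in> L b a B"
    then obtain F G where "F \<in> A" "a \<in> F" "b \<notin> F" "F' = F - {a}" "G \<in> B" "b \<in> G" "a \<notin> G" "G' = G - {b}"
      unfolding L_def link_def by auto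
    moreover have "F \<inter> G \<noteq> {}" using calculation cross_intersectingD[OF ci] by blast
    ultimately show "F' \<inter> G' \<noteq> {}" by auto
  qed
  have size: "card C \<le> ((card X - 2) choose r) + card (L i j C) + card (L j i C)"
    if C: "C \<subseteq> ksets X k" "\<And>F. F \<in> C \<Longrightarrow> i \<in> F \<or> j \<in> F" for C
  proof -
    let ?b = "{F \<in> C. {i, j} \<subseteq> F}" and ?i = "{F \<in> C. j \<notin> F \<and> i \<in> F}" and ?j = "{F \<in> C. i \<notin> F \<and> j \<in> F}"
    have "C = ?b \<union> ?i \<union> ?j" using C(2) by blast
    then have "card C = card (?b \<union> ?i \<union> ?j)" by (rule arg_cong)
    then have "card C \<le> card ?b + card ?i + card ?j"
      using card_Un_le[of "?b \<union> ?i" ?j] card_Un_le[of ?b ?i] by linarith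
    moreover have "card ?b \<le> card {F \<in> ksets X (card {i, j} + r). {i, j} \<subseteq> F}"
      using C(1) ij k finite_ksets[OF X(1)] by (intro card_mono) auto
    moreover have "\<dots> = (card X - 2) choose r"
      using card_ksets_superset[OF X(1), of "{i, j}" r] ij by (simp add: numeral_2_eq_2)
    moreover have "card (L i j C) = card ?i" "card (L j i C) = card ?j"
      unfolding L_def card_link by simp_all
    ultimately show ?thesis by linarith
  qed
  have ne: "L i j C \<noteq> {}" "L j i C \<noteq> {}"
    if "\<And>F. F \<in> C \<Longrightarrow> i \<in> F \<or> j \<in> F" "\<exists>F\<in>C. i \<notin> F" "\<exists>F\<in>C. j \<notin> F" for C
    using that unfolding L_def link_def by auto
  have hm: "card (L a b A) + card (L b a B) + ((card X - k - 1) choose Suc r) \<le> ((card X - 2) choose Suc r) + 1"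
    if "L a b A \<noteq> {}" "L b a B \<noteq> {}" "L a b A \<subseteq> ksets Y (Suc r)" "L b a B \<subseteq> ksets Y (Suc r)" for a b
  proof -
    have "card Y - Suc r = card X - k - 1" "2 * Suc r \<le> card Y" using Y(2) k X(2) by auto
    then show ?thesis using hilton_milner_cross[OF Y(1) that(3,4,1,2) Lci] Y(2) by simp
  qed
  have covAB: "\<And>F. F \<in> A \<Longrightarrow> i \<in> F \<or> j \<in> F" "\<And>F. F \<in> B \<Longrightarrow> i \<in> F \<or> j \<in> F"
    using cov by auto
  note neA = ne[OF covAB(1) nontriv(1,2)] and neB = ne[OF covAB(2) nontriv(3,4)]
  have h1: "card (L i j A) + card (L j i B) + ((card X - k - 1) choose Suc r) \<le> ((card X - 2) choose Suc r) + 1"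
    by (rule hm[OF neA(1) neB(2) Lsub(1)[OF sub(1)] Lsub(2)[OF sub(2)]])
  have h2: "card (L j i A) + card (L i j B) + ((card X - k - 1) choose Suc r) \<le> ((card X - 2) choose Suc r) + 1"
    by (rule hm[OF neA(2) neB(1) Lsub(2)[OF sub(1)] Lsub(1)[OF sub(2)]])
  have "card X - 1 = Suc (card X - 2)" using X by linarith
  then have pas: "(card X - 1) choose Suc r = ((card X - 2) choose r) + ((card X - 2) choose Suc r)" by simp
  have "card A \<le> ((card X - 2) choose r) + card (L i j A) + card (L j i A)"
    "card B \<le> ((card X - 2) choose r) + card (L i j B) + card (L j i B)"
    using size[OF sub(1) covAB(1)] size[OF sub(2) covAB(2)] by auto
  then show ?thesis using h1 h2 pas k by simp
qed

text \<open>Each member contains \<open>i\<close> together with \<open>s\<close> further points of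
  \<open>{1..m}\<close>, so the \<open>(m - 1) choose s\<close> sets of this form cover the
  family.\<close>

lemma card_containing_many_le:
  assumes B: "B \<subseteq> ksets {1..n} k" and i: "i \<in> {1..m}" and m: "m \<le> n" and s: "s < k"
    and many: "\<And>F. F \<in> B \<Longrightarrow> i \<in> F \<and> s + 1 \<le> card (F \<inter> {1..m})"
  shows "card B \<le> ((m - 1) choose s) * ((n - 1 - s) choose (k - 1 - s))"
proof -
  define TT where "TT = insert i ` ksets ({1..m} - {i}) s"
  have fin: "finite (ksets ({1..m} - {i}) s)" by (rule finite_ksets) simp
  have "card B \<le> card TT * ((card {1..n} - (s + 1)) choose (k - (s + 1)))"
  proof (rule card_covered_le[OF _ B])
    show "finite TT" using fin by (simp add: TT_def)
    show "TT \<subseteq> ksets {1..n} (s + 1)"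
    proof
      fix T assume "T \<in> TT"
      then obtain G where G: "G \<in> ksets ({1..m} - {i}) s" "T = insert i G" by (auto simp: TT_def)
      have "finite G" "i \<notin> G" using G(1) by (auto simp: ksets_def intro: finite_subset)
      then show "T \<in> ksets {1..n} (s + 1)" using G i m by (auto simp: ksets_def)
    qed
    fix F assume "F \<in> B"
    then have F: "i \<in> F" "s + 1 \<le> card (F \<inter> {1..m})" using many by auto
    then have "s \<le> card (F \<inter> {1..m} - {i})" using i by simp
    then obtain G where G: "G \<subseteq> F \<inter> {1..m} - {i}" "card G = s" "finite G"
      by (rule obtain_subset_with_card_n)
    then have "insert i G \<in> TT" "insert i G \<subseteq> F" using F by (auto simp: TT_def ksets_def)
    then show "\<exists>T\<in>TT. T \<subseteq> F" by blast
  qed (use s in auto)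
  also have "\<dots> \<le> card (ksets ({1..m} - {i}) s) * ((n - 1 - s) choose (k - 1 - s))"
    using card_image_le[OF fin, of "insert i"] by (simp add: TT_def)
  also have "card (ksets ({1..m} - {i}) s) = (m - 1) choose s" using i by (simp add: card_ksets)
  finally show ?thesis .
qed

subsection \<open>Shifted families\<close>

text \<open>The condition \<open>1 \<le> i\<close> keeps exchanges inside the ground set
  \<open>{1..n}\<close>, as \<open>0\<close> is a natural number too.\<close>

definition shifted :: "nat set set \<Rightarrow> bool" where
  "shifted A \<longleftrightarrow> (\<forall>F\<in>A. \<forall>j\<in>F. \<forall>i. 1 \<le> i \<and> i < j \<and> i \<notin> F \<longrightarrow> insert i (F - {j}) \<in> A)"

lemma shiftedD:
  "shifted A \<Longrightarrow> F \<in> A \<Longrightarrow> j \<in> F \<Longrightarrow> 1 \<le> i \<Longrightarrow> i < j \<Longrightarrow> i \<notin> F \<Longrightarrow> insert i (F - {j}) \<in> A"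
  by (auto simp: shifted_def)

text \<open>The prefix condition says that, in increasing order, each element of \<open>G\<close> is
  at most the corresponding element of \<open>F\<close>. Exchanging the least element
  \<open>j\<close> of \<open>F - G\<close> for the least element \<open>i\<close> of
  \<open>G - F\<close> moves downwards, keeps the condition and brings \<open>F\<close> closer to
  \<open>G\<close>.\<close>

lemma shifted_dominates:
  assumes "shifted A" "F \<in> A" "finite F" "finite G" "card G = card F" "0 \<notin> G"
    and "\<And>x. card (F \<inter> {..x}) \<le> card (G \<inter> {..x})"
  shows "G \<in> A"
  using assms(2,3,5,7)
proof (induction "card (F - G)" arbitrary: F rule: less_induct)
  case less
  note F = less.prems
  show ?case
  proof (cases "F - G = {}")
    case True
    then have "F = G" using F(3) assms(4) by (intro card_subset_eq) auto
    then show ?thesis using F by simp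
  next
    case False
    have ne: "G - F \<noteq> {}"
    proof
      assume "G - F = {}"
      then have "G = F" using F by (intro card_subset_eq) auto
      then show False using False by simp
    qed
    define i where "i = Min (G - F)"
    define j where "j = Min (F - G)"
    have i: "i \<in> G" "i \<notin> F" and j: "j \<in> F" "j \<notin> G"
      using Min_in[of "G - F"] Min_in[of "F - G"] ne False F(2) assms(4) by (auto simp: i_def j_def)
    have il: "y \<in> F" if "y \<in> G" "y < i" for y
      using that Min_le[of "G - F" y] assms(4) unfolding i_def by fastforce
    have jl: "y \<in> G" if "y \<in> F" "y < j" for y
      using that Min_le[of "F - G" y] F(2) unfolding j_def by fastforce
    have ij: "i < j"
    proof (rule ccontr)
      assume "\<not> i < j"
      then have "j < i" using i j by (metis linorder_neqE_nat)
      then have "G \<inter> {..j} \<subset> F \<inter> {..j}" using il j by auto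
      then have "card (G \<inter> {..j}) < card (F \<inter> {..j})" using F(2) by (intro psubset_card_mono) auto
      then show False using F(4)[of j] by simp
    qed
    define F' where "F' = insert i (F - {j})"
    have "i \<noteq> 0" using i assms(6) by metis
    then have F'A: "F' \<in> A" unfolding F'_def using shiftedD[OF assms(1) F(1) j(1)] ij i by simp
    have cF': "card F' = card F" unfolding F'_def using F(2) i j card_Suc_Diff1[of F j] by simp
    have "F' - G = (F - G) - {j}" using i unfolding F'_def by auto
    then have dec: "card (F' - G) < card (F - G)"
      using F(2) j by (metis DiffI card_Diff1_less finite_Diff)
    show ?thesis
    proof (rule less.hyps[OF dec F'A])
      show "finite F'" using F(2) by (simp add: F'_def)
      show "card G = card F'" using F(3) cF' by simp
      fix x
      \<comment> \<open>Only on the middle range does the exchange raise the prefix count of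
        \<open>F\<close>; there the prefix of \<open>F'\<close> is contained in \<open>G\<close>,
        because \<open>j\<close> is the first element of \<open>F\<close> outside
        \<open>G\<close>.\<close>
      consider "x < i" | "i \<le> x" "x < j" | "j \<le> x" by linarith
      then show "card (F' \<inter> {..x}) \<le> card (G \<inter> {..x})"
      proof cases
        case 1
        then have "F' \<inter> {..x} = F \<inter> {..x}" using ij unfolding F'_def by auto
        then show ?thesis using F(4)[of x] by simp
      next
        case 2
        then have "F' \<inter> {..x} \<subseteq> G \<inter> {..x}" using jl i unfolding F'_def by auto
        then show ?thesis using assms(4) by (intro card_mono) auto
      next
        case 3
        then have "F' \<inter> {..x} = insert i (F \<inter> {..x} - {j})" using ij unfolding F'_def by auto
        then have "card (F' \<inter> {..x}) = card (F \<inter> {..x})"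
          using F(2) i j 3 card_Suc_Diff1[of "F \<inter> {..x}" j] by simp
        then show ?thesis using F(4)[of x] by simp
      qed
    qed
  qed
qed

text \<open>The \<open>t\<close>-th smallest element of \<open>F\<close> is at least
  \<open>s + t\<close>, while that of a \<open>k\<close>-subset of \<open>{1..k + s}\<close> is at
  most \<open>s + t\<close>.\<close>

lemma shifted_missing_initial:
  assumes "shifted A" "A \<subseteq> ksets {1..n} k" "F \<in> A" "F \<inter> {1..s} = {}"
    and "G \<subseteq> {1..k + s}" "card G = k"
  shows "G \<in> A"
proof -
  have F: "F \<subseteq> {1..n}" "card F = k" using assms by (auto simp: ksets_def)
  have fin: "finite F" "finite G" using F assms(5) by (auto intro: finite_subset)
  show ?thesis
  proof (rule shifted_dominates[OF assms(1,3) fin])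
    show "card G = card F" using assms F by simp
    show "0 \<notin> G" using assms(5) by auto
    fix x
    show "card (F \<inter> {..x}) \<le> card (G \<inter> {..x})"
    proof (cases "k + s \<le> x")
      case True
      then have "G \<inter> {..x} = G" using assms(5) by auto
      then show ?thesis using card_mono[of F "F \<inter> {..x}"] fin F assms(6) by simp
    next
      case False
      have "F \<inter> {..x} \<subseteq> {s + 1..x}" using assms(4) F(1) by fastforce
      then have 1: "card (F \<inter> {..x}) \<le> x - s" using card_mono[of "{s + 1..x}"] by fastforce
      have "G \<subseteq> (G \<inter> {..x}) \<union> {x + 1..k + s}" using assms(5) by auto
      then have "card G \<le> card ((G \<inter> {..x}) \<union> {x + 1..k + s})" using fin by (intro card_mono) auto
      also have "\<dots> \<le> card (G \<inter> {..x}) + (k + s - x)" using card_Un_le[of "G \<inter> {..x}" "{x + 1..k + s}"] by simp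
      finally show ?thesis using 1 False assms(6) by linarith
    qed
  qed
qed

text \<open>Otherwise \<open>{1..k + s} - G\<close> would contain a \<open>k\<close>-set, which
  belongs to \<open>A\<close> by the preceding lemma and misses \<open>G\<close>.\<close>

lemma cross_missing_initial:
  assumes "shifted A" "A \<subseteq> ksets {1..n} k" "F \<in> A" "F \<inter> {1..s} = {}"
    and "cross_intersecting A B" "G \<in> B"
  shows "s + 1 \<le> card (G \<inter> {1..k + s})"
proof (rule ccontr)
  assume "\<not> ?thesis"
  moreover have "card ({1..k + s} - G) = k + s - card (G \<inter> {1..k + s})"
    by (simp add: card_Diff_subset_Int Int_commute)
  ultimately have "k \<le> card ({1..k + s} - G)" by simp
  then obtain H where H: "H \<subseteq> {1..k + s} - G" "card H = k"
    by (rule obtain_subset_with_card_n)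
  then have "H \<in> A" by (intro shifted_missing_initial[OF assms(1-4)]) auto
  then show False using cross_intersectingD[OF assms(5) _ assms(6)] H by blast
qed

text \<open>If \<open>G\<close> had at most one element \<open>g\<close> in \<open>{1..4}\<close>,
  it could be pushed down to \<open>G'\<close>, made of \<open>g\<close> and
  \<open>{5..k + 3}\<close>. The sparse trace of \<open>F\<close> lets it be pushed down to the rest
  of \<open>{1..4}\<close> followed by \<open>{k + 4..2 * k}\<close>, disjoint from
  \<open>G'\<close>. That \<open>F\<close> avoids \<open>1\<close> is what allows
  \<open>g = 1\<close>.\<close>

lemma cross_two_of_four:
  assumes sh: "shifted A" "shifted B" and sub: "A \<subseteq> ksets {1..n} k" "B \<subseteq> ksets {1..n} k"
    and ci: "cross_intersecting A B" and k: "3 \<le> k"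
    and F: "F \<in> A" "1 \<notin> F" "card (F \<inter> {1..k + 3}) \<le> 3" and G: "G \<in> B"
  shows "2 \<le> card (G \<inter> {1..4})"
proof (rule ccontr)
  assume "\<not> ?thesis"
  then have "card (G \<inter> {1..4}) \<le> 1" by simp
  \<comment> \<open>If \<open>G\<close> misses \<open>{1..4}\<close> altogether, \<open>g\<close>
    defaults to \<open>1\<close>.\<close>
  then obtain g where g: "g \<in> {1..4}" "G \<inter> {1..4} \<subseteq> {g}"
  proof (cases "G \<inter> {1..4} = {}")
    case False
    then have "card (G \<inter> {1..4}) = 1"
      using \<open>card (G \<inter> {1..4}) \<le> 1\<close> by (metis One_nat_def card_0_eq finite_Int finite_atLeastAtMost le_Suc_eq le_zero_eq)
    then obtain g where "G \<inter> {1..4} = {g}" by (metis card_1_singletonE)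
    then show ?thesis using that by blast
  qed (use that[of 1] in auto)
  have FG: "F \<subseteq> {1..n}" "card F = k" "G \<subseteq> {1..n}" "card G = k" using F G sub by (auto simp: ksets_def)
  have fin: "finite F" "finite G" using FG by (auto intro: finite_subset)
  define G' where "G' = insert g {5..k + 3}"
  define H where "H = ({1..4} - {g}) \<union> {k + 4..2 * k}"
  have g4: "card ({1..4} - {g}) = 3" using g by simp
  have cG': "card G' = k" using g k by (auto simp: G'_def)
  have "card H = card ({1..4} - {g}) + card {k + 4..2 * k}"
    unfolding H_def using k by (intro card_Un_disjoint) auto
  then have cH: "card H = k" using g4 k by simp
  have "G' \<in> B"
  proof (rule shifted_dominates[OF sh(2) G fin(2)])
    show "finite G'" "card G' = card G" "0 \<notin> G'" using cG' FG g by (auto simp: G'_def)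
    fix x
    show "card (G \<inter> {..x}) \<le> card (G' \<inter> {..x})"
    proof (cases "x \<le> k + 3")
      case True
      have "y \<in> G'" if "y \<in> G" "y \<le> x" for y
      proof (cases "y \<le> 4")
        case True
        then have "y \<in> G \<inter> {1..4}" using that FG by auto
        then show ?thesis using g by (auto simp: G'_def)
      next
        case False then show ?thesis using that \<open>x \<le> k + 3\<close> by (auto simp: G'_def)
      qed
      then show ?thesis by (intro card_mono) auto
    next
      case False
      then have "G' \<inter> {..x} = G'" using g by (auto simp: G'_def)
      then show ?thesis using card_mono[of G "G \<inter> {..x}"] fin FG cG' by simp
    qed
  qed
  moreover have "H \<in> A"
  proof (rule shifted_dominates[OF sh(1) F(1) fin(1)])
    show "finite H" "card H = card F" "0 \<notin> H" using cH FG by (auto simp: H_def)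
    fix x
    consider "x \<le> 4" | "4 < x" "x \<le> k + 3" | "k + 3 < x" "x < 2 * k" | "2 * k \<le> x" by linarith
    then show "card (F \<inter> {..x}) \<le> card (H \<inter> {..x})"
    proof cases
      case 1
      have "F \<inter> {..x} \<subseteq> {1..x} - {1}" using FG F(2) by auto
      then have "card (F \<inter> {..x}) \<le> card ({1..x} - {1})" by (intro card_mono) auto
      also have "\<dots> = x - 1" by (cases "x = 0") auto
      also have "\<dots> \<le> card ({1..x} - {g})" by (auto simp: card_Diff_singleton_if)
      also have "\<dots> \<le> card (H \<inter> {..x})" using 1 by (intro card_mono) (auto simp: H_def)
      finally show ?thesis .
    next
      case 2
      have "card (F \<inter> {..x}) \<le> card (F \<inter> {1..k + 3})" using 2 FG fin by (intro card_mono) auto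
      also have "\<dots> \<le> card ({1..4} - {g})" using g4 F(3) by simp
      also have "\<dots> \<le> card (H \<inter> {..x})" using 2 by (intro card_mono) (auto simp: H_def)
      finally show ?thesis .
    next
      case 3
      have "F \<inter> {..x} \<subseteq> (F \<inter> {1..k + 3}) \<union> {k + 4..x}" using FG by auto
      then have "card (F \<inter> {..x}) \<le> card ((F \<inter> {1..k + 3}) \<union> {k + 4..x})" using fin by (intro card_mono) auto
      also have "\<dots> \<le> card (F \<inter> {1..k + 3}) + card {k + 4..x}" by (rule card_Un_le)
      also have "\<dots> \<le> card ({1..4} - {g}) + card {k + 4..x}" using g4 F(3) by simp
      also have "\<dots> = card (({1..4} - {g}) \<union> {k + 4..x})"
        using k by (intro card_Un_disjoint[symmetric]) auto
      also have "\<dots> \<le> card (H \<inter> {..x})" using 3 by (intro card_mono) (auto simp: H_def)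
      finally show ?thesis .
    next
      case 4
      then have "H \<inter> {..x} = H" using k by (auto simp: H_def)
      then show ?thesis using card_mono[of F "F \<inter> {..x}"] fin FG cH by simp
    qed
  qed
  moreover have "H \<inter> G' = {}" using g by (auto simp: H_def G'_def)
  ultimately show False using cross_intersectingD[OF ci] by blast
qed

subsection \<open>Binomial estimates\<close>

text \<open>Writes the quotient of the two binomials as the product of
  \<open>(a - i) / (b - i)\<close> and bounds every factor by \<open>p / q\<close>, with
  denominators cleared.\<close>

lemma binomial_ratio_le:
  fixes p q :: real
  assumes "0 \<le> p" "0 \<le> q" "\<And>i. i < r \<Longrightarrow> real (a - i) * q \<le> real (b - i) * p"
  shows "real (a choose r) * q ^ r \<le> real (b choose r) * p ^ r"
  using assms(3)
proof (induction r)
  case (Suc r)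
  have step: "real (Suc r) * real (x choose Suc r) = real (x - r) * real (x choose r)" for x
    by (metis binomial_absorb_comp binomial_absorption of_nat_mult)
  have "real (Suc r) * (real (a choose Suc r) * q ^ Suc r)
      = (real (a choose r) * q ^ r) * (real (a - r) * q)"
    using step[of a] by (simp add: algebra_simps)
  also have "\<dots> \<le> (real (b choose r) * p ^ r) * (real (b - r) * p)"
    by (rule mult_mono) (use Suc assms in auto)
  also have "\<dots> = real (Suc r) * (real (b choose Suc r) * p ^ Suc r)"
    using step[of b] by (simp add: algebra_simps)
  finally show ?case by (simp add: mult_le_cancel_left_pos)
qed simp

lemma ln2_bounds: "1 / 2 \<le> ln (2 :: real)" "ln (2 :: real) \<le> 7 / 10"
proof -
  have "ln (1 / 2) \<le> 1 / 2 - (1 :: real)" by (rule ln_le_minus_one) simp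
  then show "1 / 2 \<le> ln (2 :: real)" by (simp add: ln_div)
  \<comment> \<open>At 7/10 itself the quadratic Taylor polynomial is only 1.945. At a quarter of
    the exponent it is accurate enough for its fourth power to exceed 2.\<close>
  have "1 + 7 / 40 + (7 / 40)\<^sup>2 / 2 \<le> exp (7 / 40 :: real)"
    by (rule exp_lower_Taylor_quadratic) simp
  then have "(1 + 7 / 40 + (7 / 40)\<^sup>2 / 2) ^ 4 \<le> exp (7 / 40 :: real) ^ 4"
    by (intro power_mono) auto
  also have "\<dots> = exp (7 / 10)" by (simp flip: exp_of_nat_mult)
  finally have "2 \<le> exp (7 / 10 :: real)" by (simp add: power2_eq_square power4_eq_xxxx)
  then have "ln 2 \<le> ln (exp (7 / 10 :: real))" by (subst ln_le_cancel_iff) auto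
  then show "ln (2 :: real) \<le> 7 / 10" by simp
qed

text \<open>With \<open>N\<close>, \<open>M\<close> and \<open>q\<close> as in the proof,
  \<open>N / M\<close> is at most \<open>(1 + k / q) ^ (k - 1)\<close>, hence at most
  \<open>exp (k * (k - 1) / q)\<close>. The hypothesis bounds this by 2 with slack
  \<open>exp (- L / q)\<close>, which yields the \<open>+ 2\<close>. That surplus pays for the two
  extra units in \<open>two_cover_bound\<close>.\<close>

lemma binomial_more_than_half:
  fixes n k :: nat
  assumes k: "2 \<le> k" and n: "2 * k < n" and h: "real k * (real k - 1) \<le> ln 2 * (real n - 2 * real k)"
  shows "((n - 1) choose (k - 1)) + 2 \<le> 2 * ((n - k - 1) choose (k - 1))"
proof -
  have "ln 2 * (real n - 2 * real k) \<le> 7 / 10 * (real n - 2 * real k)"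
    using ln2_bounds n by (intro mult_right_mono) auto
  then have h': "real k * (real k - 1) \<le> 7 / 10 * (real n - 2 * real k)" using h by linarith
  show ?thesis
  proof (cases "k = 2")
    case True
    then have "real n > 6" using h' by simp
    then show ?thesis using True by (simp add: numeral_2_eq_2)
  next
    case False
    then have k3: "3 \<le> k" using k by simp
    define L where "L = ln (2 :: real)"
    \<comment> \<open>\<open>q\<close> is the smallest denominator in the product for
      \<open>N / M\<close>, the one at \<open>i = k - 2\<close>, and \<open>p\<close> is the
      numerator above it; that factor is the largest.\<close>
    define q where "q = real n - 2 * real k + 1"
    define p where "p = real n - real k + 1"
    define N where "N = real ((n - 1) choose (k - 1))"
    define M where "M = real ((n - k - 1) choose (k - 1))"
    have q: "1 < q" using n by (simp add: q_def)
    have p: "p = q + real k" by (simp add: p_def q_def)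
    have NM: "N * q ^ (k - 1) \<le> M * p ^ (k - 1)"
      unfolding N_def M_def
    proof (rule binomial_ratio_le)
      fix i assume i: "i < k - 1"
      define u where "u = real n - 1 - real i"
      have u: "real (n - 1 - i) = u" "real (n - k - 1 - i) = u - real k"
        using i n k by (auto simp: u_def of_nat_diff)
      have "p \<le> u" using i by (simp add: u_def p_def)
      then have "real k * p \<le> real k * u" by (intro mult_left_mono) auto
      then show "real (n - 1 - i) * q \<le> real (n - k - 1 - i) * p"
        unfolding u p by (simp add: algebra_simps)
    qed (use q p in auto)
    have "p ^ (k - 1) = q ^ (k - 1) * (1 + real k / q) ^ (k - 1)"
      using q p by (simp add: field_simps flip: power_mult_distrib)
    also have "\<dots> \<le> q ^ (k - 1) * exp (real k / q) ^ (k - 1)"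
      using q by (intro mult_left_mono power_mono) (auto simp: exp_ge_add_one_self intro: add_nonneg_nonneg)
    also have "exp (real k / q) ^ (k - 1) = exp (real k * (real k - 1) / q)"
      using k by (simp add: of_nat_diff mult.commute flip: exp_of_nat_mult)
    also have "\<dots> \<le> exp (L - L / q)"
    proof -
      have "real k * (real k - 1) / q \<le> L * (q - 1) / q"
        using h q by (intro divide_right_mono) (auto simp: L_def q_def)
      also have "\<dots> = L - L / q" using q by (simp add: field_simps)
      finally show ?thesis by simp
    qed
    also have "exp (L - L / q) = 2 / exp (L / q)" by (simp add: exp_diff L_def)
    finally have "p ^ (k - 1) \<le> q ^ (k - 1) * (2 / exp (L / q))" using q by simp
    then have "M * p ^ (k - 1) \<le> M * (q ^ (k - 1) * (2 / exp (L / q)))"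
      by (intro mult_left_mono) (auto simp: M_def)
    with NM have "q ^ (k - 1) * N \<le> q ^ (k - 1) * (M * (2 / exp (L / q)))"
      by (simp add: algebra_simps)
    then have "N \<le> M * (2 / exp (L / q))" using q by (simp only: mult_le_cancel_left_pos zero_less_power)
    then have "N * exp (L / q) \<le> 2 * M" by (simp add: field_simps)
    moreover have "N * (1 + L / q) \<le> N * exp (L / q)"
      by (intro mult_left_mono exp_ge_add_one_self) (auto simp: N_def)
    \<comment> \<open>As \<open>k\<close> is at least 3, \<open>N\<close> is at least
      \<open>(n - 1) choose 2\<close>, which exceeds \<open>4 * q\<close>; and \<open>L\<close> is
      at least 1/2.\<close>
    moreover have "2 \<le> N * (L / q)"
    proof -
      have "3 * 2 \<le> real k * (real k - 1)" using k3 by (intro mult_mono) auto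
      then have n12: "12 < n" using h' k3 by simp
      have "((n - 1) choose 2) \<le> ((n - 1) choose (k - 1))"
        by (rule binomial_mono) (use k3 n in auto)
      then have "real ((n - 1) choose 2) \<le> N" by (simp add: N_def)
      moreover have "real ((n - 1) choose 2) = (real n - 1) * (real n - 2) / 2"
      proof -
        have "2 * ((n - 1) choose 2) = (n - 1) * (n - 2)"
          using binomial_absorption[of 1 "n - 1"] by (simp add: numeral_2_eq_2)
        then have "2 * real ((n - 1) choose 2) = real (n - 1) * real (n - 2)" by (metis of_nat_mult of_nat_numeral)
        then show ?thesis using n12 by (simp add: of_nat_diff)
      qed
      ultimately have N: "(real n - 1) * (real n - 2) / 2 \<le> N" by simp
      have "4 * q \<le> (real n - 1) * (real n - 2) / 2"
      proof -
        have "8 * (real n - 2) \<le> (real n - 1) * (real n - 2)" using n12 by (intro mult_right_mono) auto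
        then show ?thesis using k3 by (simp add: q_def)
      qed
      then have "4 * q \<le> N" using N by simp
      moreover have "N * (1 / 2) \<le> N * L" using ln2_bounds by (intro mult_left_mono) (auto simp: L_def N_def)
      ultimately have "2 * q \<le> N * L" by simp
      then show ?thesis using q by (simp add: field_simps)
    qed
    ultimately have "N + 2 \<le> 2 * M" by (simp add: algebra_simps)
    then show ?thesis unfolding N_def M_def by linarith
  qed
qed

text \<open>Here the factor at \<open>i = 0\<close> is the largest, so \<open>M / N\<close> is at
  most \<open>((n - k) / (n - 1)) ^ (k - 1)\<close>, hence at most
  \<open>exp (- (k - 1)^2 / (n - 1))\<close>.\<close>

lemma binomial_less_than_half:
  fixes n k :: nat
  assumes k: "2 \<le> k" and n: "2 * k < n" and h: "ln 2 * (real n - 1) \<le> real k * (real k - 2)"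
  shows "2 * ((n - k) choose (k - 1)) < ((n - 1) choose (k - 1))"
proof -
  define N where "N = real ((n - 1) choose (k - 1))"
  define M where "M = real ((n - k) choose (k - 1))"
  define q where "q = real n - 1"
  have q: "0 < q" using n k by (simp add: q_def)
  have nk: "real n - real k = q * (1 + - ((real k - 1) / q))" using q by (simp add: field_simps q_def)
  have "M * q ^ (k - 1) \<le> N * (real n - real k) ^ (k - 1)"
    unfolding N_def M_def
  proof (rule binomial_ratio_le)
    fix i assume i: "i < k - 1"
    have "real (n - k - i) = real n - real k - real i" "real (n - 1 - i) = real n - 1 - real i"
      using i n by (auto simp: of_nat_diff)
    moreover have "real i * (real n - real k) \<le> real i * (real n - 1)"
      using k by (intro mult_left_mono) auto
    ultimately show "real (n - k - i) * q \<le> real (n - 1 - i) * (real n - real k)"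
      by (simp add: q_def algebra_simps)
  qed (use q n in auto)
  also have "real n - real k = q * (1 + - ((real k - 1) / q))" by (rule nk)
  also have "N * \<dots> ^ (k - 1) \<le> N * (q * exp (- ((real k - 1) / q))) ^ (k - 1)"
  proof (intro mult_left_mono power_mono exp_ge_add_one_self)
    show "0 \<le> q * (1 + - ((real k - 1) / q))" using nk n by linarith
  qed (use q in \<open>auto simp: N_def\<close>)
  also have "\<dots> = N * exp (- ((real k - 1) / q)) ^ (k - 1) * q ^ (k - 1)" by (simp add: power_mult_distrib)
  finally have "M \<le> N * exp (- ((real k - 1) / q)) ^ (k - 1)"
    using q by (simp add: mult_le_cancel_right_pos)
  also have "exp (- ((real k - 1) / q)) ^ (k - 1) = exp (- ((real k - 1)\<^sup>2 / q))"
    using k by (simp add: of_nat_diff power2_eq_square flip: exp_of_nat_mult)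
  also have "N * \<dots> < N * (1 / 2)"
  proof -
    \<comment> \<open>Strict because \<open>k * (k - 2)\<close> is one less than the square of
      \<open>k - 1\<close>.\<close>
    have "ln 2 * q < (real k - 1)\<^sup>2" using h by (simp add: q_def power2_eq_square algebra_simps)
    then have "ln 2 < (real k - 1)\<^sup>2 / q" using q by (simp add: field_simps)
    then have "exp (- ((real k - 1)\<^sup>2 / q)) < exp (- ln 2)" by simp
    then have "exp (- ((real k - 1)\<^sup>2 / q)) < 1 / 2" by (simp add: exp_minus inverse_eq_divide)
    moreover have "0 < N" using n by (simp add: N_def)
    ultimately show ?thesis by (intro mult_strict_left_mono)
  qed
  finally have "2 * M < N" by simp
  then show ?thesis unfolding N_def M_def by linarith
qed

text \<open>Passing from \<open>s\<close> to \<open>s + 1\<close> multiplies the product by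
  \<open>(k + s) * (k - 1 - s) / ((s + 1) * (n - 1 - s))\<close>. Here
  \<open>(k + s) * (k - 1 - s)\<close> is at most \<open>k * (k - 1)\<close> and
  \<open>n - 1 - s\<close> is at least \<open>n - 2 * k\<close>, so each step costs at most
  \<open>ln 2 / (s + 1)\<close>.\<close>

lemma many_elements_count_le:
  fixes n k s :: nat
  assumes n: "2 * k < n" and h: "real k * (real k - 1) \<le> ln 2 * (real n - 2 * real k)" and "s < k"
  shows "fact s * (real ((k + s - 1) choose s) * real ((n - 1 - s) choose (k - 1 - s)))
    \<le> ln 2 ^ s * real ((n - 1) choose (k - 1))"
  using \<open>s < k\<close>
proof (induction s)
  case (Suc s)
  define a where "a = real ((k + s - 1) choose s)"
  define b where "b = real ((n - 1 - s) choose (k - 1 - s))"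
  define a' where "a' = real ((k + s) choose Suc s)"
  define b' where "b' = real ((n - 2 - s) choose (k - 2 - s))"
  have a': "real (Suc s) * a' = real (k + s) * a"
    unfolding a_def a'_def using Suc.prems binomial_absorption[of s "k + s"] by (metis of_nat_mult)
  have b': "real (n - 1 - s) * b' = real (k - 1 - s) * b"
  proof -
    have "Suc (k - 2 - s) = k - 1 - s" "n - 1 - s - 1 = n - 2 - s" using Suc.prems by auto
    then show ?thesis unfolding b_def b'_def
      using binomial_absorption[of "k - 2 - s" "n - 1 - s"] by (metis of_nat_mult)
  qed
  have pos: "0 < real (n - 1 - s)" using Suc.prems n by simp
  have "real (k + s) * real (k - 1 - s) \<le> real k * (real k - 1)"
    using Suc.prems by (simp add: of_nat_diff algebra_simps)
  also have "\<dots> \<le> ln 2 * (real n - 2 * real k)" by (rule h)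
  also have "\<dots> \<le> ln 2 * real (n - 1 - s)"
    using Suc.prems n ln2_bounds by (intro mult_left_mono) (auto simp: of_nat_diff)
  finally have ks: "real (k + s) * real (k - 1 - s) \<le> ln 2 * real (n - 1 - s)" .
  have "real (n - 1 - s) * (real (Suc s) * (a' * b')) = (real (Suc s) * a') * (real (n - 1 - s) * b')"
    by (simp add: algebra_simps)
  also have "\<dots> = (real (k + s) * real (k - 1 - s)) * (a * b)"
    unfolding a' b' by (simp add: algebra_simps)
  also have "\<dots> \<le> (ln 2 * real (n - 1 - s)) * (a * b)"
    using ks by (intro mult_right_mono) (auto simp: a_def b_def)
  also have "\<dots> = real (n - 1 - s) * (ln 2 * (a * b))" by (simp add: algebra_simps)
  finally have "real (Suc s) * (a' * b') \<le> ln 2 * (a * b)" using pos by (simp add: mult_le_cancel_left_pos)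
  then have "fact s * (real (Suc s) * (a' * b')) \<le> fact s * (ln 2 * (a * b))"
    by (intro mult_left_mono) auto
  also have "\<dots> = ln 2 * (fact s * (a * b))" by simp
  also have "\<dots> \<le> ln 2 * (ln 2 ^ s * real ((n - 1) choose (k - 1)))"
    using Suc by (intro mult_left_mono) (auto simp: a_def b_def)
  finally show ?case by (simp add: a'_def b'_def algebra_simps)
qed simp

text \<open>Turns the estimate for \<open>s + 1\<close> covering points into one half. At
  \<open>s = 2\<close> it reads 2.94 against 2 and fails, which is why that case is treated
  separately.\<close>

lemma fact_bound: "3 \<le> s \<Longrightarrow> 2 * (real s + 1) * (7 / 10) ^ s \<le> (fact s :: real)"
proof (induction s rule: dec_induct)
  case base
  then show ?case by (simp add: fact_numeral power3_eq_cube)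
next
  case (step s)
  have "2 * (real (Suc s) + 1) * (7 / 10) ^ Suc s = (7 / 10 * (real s + 2)) * (2 * (7 / 10) ^ s)" by simp
  also have "\<dots> \<le> (real (Suc s) * (real s + 1)) * (2 * (7 / 10) ^ s)"
  proof (intro mult_right_mono)
    have "4 * (real s + 1) \<le> real (Suc s) * (real s + 1)" using step by (intro mult_right_mono) auto
    then show "7 / 10 * (real s + 2) \<le> real (Suc s) * (real s + 1)" by (simp add: algebra_simps)
  qed simp
  also have "\<dots> = real (Suc s) * (2 * (real s + 1) * (7 / 10) ^ s)" by simp
  also have "\<dots> \<le> real (Suc s) * fact s" using step by (intro mult_left_mono) auto
  finally show ?case by simp
qed

text \<open>Absorbing twice reduces the claim to
  \<open>12 * k * (k - 1) * (k - 2) \<le> (n - 1) * (n - 2)\<close>. Since \<open>n\<close> is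
  quadratic in \<open>k\<close> by \<open>h\<close>, the right side is of fourth order in
  \<open>k\<close>.\<close>

lemma two_of_four_count_le:
  fixes n k :: nat
  assumes k: "3 \<le> k" and n: "2 * k < n" and h: "real k * (real k - 1) \<le> ln 2 * (real n - 2 * real k)"
  shows "12 * k * ((n - 3) choose (k - 3)) \<le> ((n - 1) choose (k - 1))"
proof -
  define c where "c = real ((n - 3) choose (k - 3))"
  define N where "N = real ((n - 1) choose (k - 1))"
  have "ln 2 * (real n - 2 * real k) \<le> 7 / 10 * (real n - 2 * real k)"
    using ln2_bounds n by (intro mult_right_mono) auto
  then have h': "real k * (real k - 1) \<le> 7 / 10 * (real n - 2 * real k)" using h by linarith
  have e1: "real (k - 1) * N = real (n - 1) * real ((n - 2) choose (k - 2))"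
  proof -
    have "Suc (k - 2) = k - 1" "n - 1 - 1 = n - 2" using k by auto
    then show ?thesis unfolding N_def using binomial_absorption[of "k - 2" "n - 1"] by (metis of_nat_mult)
  qed
  have e2: "real (k - 2) * real ((n - 2) choose (k - 2)) = real (n - 2) * c"
  proof -
    have "Suc (k - 3) = k - 2" "n - 2 - 1 = n - 3" using k by auto
    then show ?thesis unfolding c_def using binomial_absorption[of "k - 3" "n - 2"] by (metis of_nat_mult)
  qed
  define x where "x = real k"
  define y where "y = real n"
  have xy: "3 \<le> x" "2 * x < y" "x * (x - 1) \<le> 7 / 10 * (y - 2 * x)"
    using k n h' by (auto simp: x_def y_def)
  have real_diffs: "real (k - 1) = x - 1" "real (k - 2) = x - 2" "real (n - 1) = y - 1" "real (n - 2) = y - 2"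
    using k n by (auto simp: x_def y_def of_nat_diff)
  have eq: "(y - 1) * (y - 2) * c = (x - 1) * (x - 2) * N"
    using e1 e2 unfolding real_diffs by algebra
  \<comment> \<open>After scaling by 7/10, the bound on \<open>y\<close> leaves this square plus
    \<open>0.02 * x + 2.7975\<close>. The constant 84/10 is 12 times 7/10.\<close>
  have "0 \<le> (x - 11 / 4)\<^sup>2" by simp
  then have "84 / 10 * (x - 2) \<le> y - 2" using xy by (simp add: power2_eq_square right_diff_distrib left_diff_distrib)
  then have "84 / 10 * (x - 2) * (y - 2 * x) \<le> (y - 2) * (y - 1)" using xy by (intro mult_mono) auto
  moreover have "12 * (x - 2) * (x * (x - 1)) \<le> 12 * (x - 2) * (7 / 10 * (y - 2 * x))"
    using xy by (intro mult_left_mono) auto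
  moreover have "12 * (x - 2) * (7 / 10 * (y - 2 * x)) = 84 / 10 * (x - 2) * (y - 2 * x)"
    by (simp add: field_simps)
  ultimately have "12 * (x - 2) * (x * (x - 1)) \<le> (y - 2) * (y - 1)" by linarith
  then have "12 * x * ((x - 1) * (x - 2)) \<le> (y - 1) * (y - 2)" by (simp add: mult.commute mult.left_commute)
  then have "12 * x * ((x - 1) * (x - 2)) * N \<le> (y - 1) * (y - 2) * N"
    by (intro mult_right_mono) (auto simp: N_def)
  moreover have "(y - 1) * (y - 2) * (12 * x * c) = 12 * x * ((x - 1) * (x - 2)) * N"
    using eq by algebra
  ultimately have "(y - 1) * (y - 2) * (12 * x * c) \<le> (y - 1) * (y - 2) * N" by linarith
  moreover have "0 < (y - 1) * (y - 2)" using xy by (intro mult_pos_pos) auto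
  ultimately have "12 * x * c \<le> N" by (simp only: mult_le_cancel_left_pos)
  then have "real (12 * k * ((n - 3) choose (k - 3))) \<le> real ((n - 1) choose (k - 1))"
    by (simp add: x_def c_def N_def)
  then show ?thesis by (simp only: of_nat_le_iff)
qed

subsection \<open>Shifted families with a member missing an initial segment\<close>

lemma card_le_if_meets:
  assumes "finite C" "finite T" "\<And>G. G \<in> C \<Longrightarrow> G \<inter> T \<noteq> {}" "\<And>i. i \<in> T \<Longrightarrow> card {G \<in> C. i \<in> G} \<le> w"
  shows "card C \<le> card T * w"
proof -
  have "C \<subseteq> (\<Union>i\<in>T. {G \<in> C. i \<in> G})" using assms(3) by blast
  then have "card C \<le> card (\<Union>i\<in>T. {G \<in> C. i \<in> G})"
    using assms(1,2) by (intro card_mono) auto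
  also have "\<dots> \<le> (\<Sum>i\<in>T. card {G \<in> C. i \<in> G})" by (rule card_UN_le[OF assms(2)])
  also have "\<dots> \<le> (\<Sum>i\<in>T. w)" using assms(4) by (rule sum_mono)
  finally show ?thesis by simp
qed

text \<open>Each member contains a pair from \<open>{1..4}\<close> and a further point of
  \<open>{1..k + 2}\<close>. There are 6 pairs and \<open>k\<close> further points for each, hence
  at most \<open>6 * k\<close> covering triples.\<close>

lemma card_two_of_four_le:
  assumes k: "3 \<le> k" "2 * k < n" and B: "B \<subseteq> ksets {1..n} k"
    and two: "\<And>G. G \<in> B \<Longrightarrow> 2 \<le> card (G \<inter> {1..4})"
    and three: "\<And>G. G \<in> B \<Longrightarrow> 3 \<le> card (G \<inter> {1..k + 2})"
  shows "card B \<le> 6 * k * ((n - 3) choose (k - 3))"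
proof -
  define S where "S = Sigma (ksets {1..4 :: nat} 2) (\<lambda>P. {1..k + 2} - P)"
  define TT where "TT = (\<lambda>(P, x). insert x P) ` S"
  have fin4: "finite (ksets {1..4 :: nat} 2)" by (rule finite_ksets) simp
  have finS: "finite S" unfolding S_def using fin4 by auto
  have PS: "P \<subseteq> {1..4} \<and> card P = 2 \<and> finite P" if "P \<in> ksets {1..4 :: nat} 2" for P
    using that by (auto simp: ksets_def intro: finite_subset)
  have cP: "card ({1..k + 2} - P) = k" if "P \<in> ksets {1..4 :: nat} 2" for P
  proof -
    have "P \<subseteq> {1..k + 2}" if "P \<subseteq> {1..4}" using that k(1) by fastforce
    then show ?thesis using PS[OF that] by (simp add: card_Diff_subset)
  qed
  have "card S = (\<Sum>P\<in>ksets {1..4 :: nat} 2. card ({1..k + 2} - P))"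
    unfolding S_def using fin4 by (intro card_SigmaI) auto
  also have "\<dots> = (\<Sum>P\<in>ksets {1..4 :: nat} 2. k)" using cP by (intro sum.cong) auto
  also have "\<dots> = 6 * k" by (simp add: card_ksets numeral_eq_Suc)
  finally have cTT: "card TT \<le> 6 * k" unfolding TT_def using card_image_le[OF finS] by metis
  have "card B \<le> card TT * ((card {1..n} - 3) choose (k - 3))"
  proof (rule card_covered_le[OF _ B])
    show "finite TT" using finS by (simp add: TT_def)
    show "TT \<subseteq> ksets {1..n} 3"
    proof
      fix T assume "T \<in> TT"
      then obtain P x where P: "P \<in> ksets {1..4} 2" "x \<in> {1..k + 2} - P" "T = insert x P"
        by (auto simp: TT_def S_def)
      have "card T = 3" using PS[OF P(1)] P by simp
      moreover have "T \<subseteq> {1..n}" using PS[OF P(1)] P k by fastforce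
      ultimately show "T \<in> ksets {1..n} 3" by (simp add: ksets_def)
    qed
    fix G assume G: "G \<in> B"
    obtain P where P: "P \<subseteq> G \<inter> {1..4}" "card P = 2" "finite P"
      using obtain_subset_with_card_n[OF two[OF G]] by metis
    have "\<not> G \<inter> {1..k + 2} \<subseteq> P"
      using card_mono[OF P(3), of "G \<inter> {1..k + 2}"] P(2) three[OF G] by auto
    then obtain x where x: "x \<in> G" "x \<in> {1..k + 2}" "x \<notin> P" by blast
    have "(P, x) \<in> S" using P x by (auto simp: S_def ksets_def)
    then have "insert x P \<in> TT" unfolding TT_def by force
    moreover have "insert x P \<subseteq> G" using P x by auto
    ultimately show "\<exists>T\<in>TT. T \<subseteq> G" by blast
  qed (use k in auto)
  also have "\<dots> \<le> 6 * k * ((n - 3) choose (k - 3))" using cTT by simp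
  finally show ?thesis .
qed

text \<open>By \<open>meet\<close>, \<open>B\<close> is covered by its members through one of
  \<open>s + 1\<close> points, at most \<open>W s\<close> for each point. This suffices from
  \<open>s = 3\<close> on. For \<open>s = 2\<close>, two covering points would do; if
  \<open>B\<close> also has a member missing \<open>{1..2}\<close>, the roles of the families can be
  exchanged, which gives information on \<open>A\<close> as well.\<close>

lemma shifted_missing_bound:
  assumes n: "2 * k < n" and h: "real k * (real k - 1) \<le> ln 2 * (real n - 2 * real k)"
    and sub: "A \<subseteq> ksets {1..n} k" "B \<subseteq> ksets {1..n} k" and ci: "cross_intersecting A B"
    and sh: "shifted A" "shifted B"
    and F: "F \<in> A" "F \<inter> {1..s} = {}" and s: "2 \<le> s"
    and meet: "\<And>G. G \<in> A \<union> B \<Longrightarrow> G \<inter> {1..s + 1} \<noteq> {}"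
  shows "2 * card A \<le> (n - 1) choose (k - 1) \<or> 2 * card B \<le> (n - 1) choose (k - 1)"
proof (cases "B = {}")
  case False
  define N where "N = real ((n - 1) choose (k - 1))"
  \<comment> \<open>Bounds the members through one point of \<open>{1..k + t}\<close> when every
    member has more than \<open>t\<close> elements there.\<close>
  define W where "W = (\<lambda>s. ((k + s - 1) choose s) * ((n - 1 - s) choose (k - 1 - s)))"
  have fin: "finite A" "finite B" using sub finite_ksets[of "{1..n}"] by (auto intro: finite_subset)
  have many: "s + 1 \<le> card (G \<inter> {1..k + s})" if "G \<in> B" for G
    using cross_missing_initial[OF sh(1) sub(1) F ci that] .
  have cardk: "card (G \<inter> T) \<le> k" if "G \<in> A \<union> B" for G T
  proof -
    have "G \<in> ksets {1..n} k" using that sub by auto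
    then have "finite G" "card G = k" by (auto simp: ksets_def intro: finite_subset)
    then show ?thesis using card_mono[of G "G \<inter> T"] by simp
  qed
  have sk: "s < k"
  proof -
    obtain G where "G \<in> B" using False by auto
    then show ?thesis using many[of G] cardk[of G "{1..k + s}"] by simp
  qed
  have Wb: "fact t * real (W t) \<le> (7 / 10) ^ t * N" if "t < k" for t
  proof -
    have "fact t * real (W t) \<le> ln 2 ^ t * N"
      using many_elements_count_le[OF n h that] by (simp add: W_def N_def)
    also have "\<dots> \<le> (7 / 10) ^ t * N"
      using ln2_bounds by (intro mult_right_mono power_mono) (auto simp: N_def)
    finally show ?thesis .
  qed
  have contains: "card {G \<in> C. i \<in> G} \<le> W t"
    if "C \<subseteq> ksets {1..n} k" "t < k" "i \<in> {1..k + t}" "\<And>G. G \<in> C \<Longrightarrow> t + 1 \<le> card (G \<inter> {1..k + t})" for C t i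
  proof -
    have "card {G \<in> C. i \<in> G} \<le> ((k + t - 1) choose t) * ((n - 1 - t) choose (k - 1 - t))"
      by (rule card_containing_many_le) (use that n in auto)
    then show ?thesis by (simp add: W_def)
  qed
  show ?thesis
  proof (cases "3 \<le> s")
    case True
    have "card B \<le> card {1..s + 1} * W s"
    proof (rule card_le_if_meets[OF fin(2)])
      fix i assume "i \<in> {1..s + 1}"
      then show "card {G \<in> B. i \<in> G} \<le> W s" using sk many by (intro contains[OF sub(2)]) auto
    qed (use meet in auto)
    then have "card B \<le> (s + 1) * W s" by simp
    then have "real (card B) \<le> real ((s + 1) * W s)" by (simp only: of_nat_le_iff)
    then have "real (card B) \<le> (real s + 1) * real (W s)" by (simp add: algebra_simps)
    then have "fact s * (2 * real (card B)) \<le> fact s * (2 * ((real s + 1) * real (W s)))"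
      by (intro mult_left_mono) auto
    also have "\<dots> = 2 * (real s + 1) * (fact s * real (W s))" by simp
    also have "\<dots> \<le> 2 * (real s + 1) * ((7 / 10) ^ s * N)" using Wb[OF sk] by (intro mult_left_mono) auto
    also have "\<dots> = 2 * (real s + 1) * (7 / 10) ^ s * N" by simp
    also have "\<dots> \<le> fact s * N" using fact_bound[OF True] by (intro mult_right_mono) (auto simp: N_def)
    finally have "2 * real (card B) \<le> N" by (simp add: mult_le_cancel_left_pos)
    then show ?thesis unfolding N_def by linarith
  next
    case no3: False
    then have s2: "s = 2" using s by simp
    have k3: "3 \<le> k" using sk s2 by simp
    \<comment> \<open>The factor 2 on the left is \<open>fact 2\<close>. Two covering points thus
      cost at most 0.49 \<open>N\<close>, just below half; this is where 7/10 has to be a sharp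
      enough bound for \<open>ln 2\<close>.\<close>
    have W2: "2 * real (W 2) \<le> 49 / 100 * N" using Wb[of 2] sk s2 by (simp add: power2_eq_square)
    have N0: "0 \<le> N" by (simp add: N_def)
    show ?thesis
    proof (cases "\<exists>G\<in>B. G \<inter> {1..2} = {}")
      case False
      have "card B \<le> card {1..2 :: nat} * W 2"
      proof (rule card_le_if_meets[OF fin(2)])
        fix i assume "i \<in> {1..2 :: nat}"
        then show "card {G \<in> B. i \<in> G} \<le> W 2" using sk many s2 by (intro contains[OF sub(2)]) auto
      qed (use False in auto)
      then have "real (card B) \<le> 2 * real (W 2)" by simp
      then have "2 * real (card B) \<le> N" using W2 N0 by linarith
      then show ?thesis unfolding N_def by linarith
    next
      case True
      then obtain G0 where G0: "G0 \<in> B" "G0 \<inter> {1..2} = {}" by blast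
      have manyA: "2 + 1 \<le> card (G \<inter> {1..k + 2})" if "G \<in> A" for G
        using cross_missing_initial[OF sh(2) sub(2) G0 _ that] ci cross_intersecting_commute by blast
      txt \<open>Every member of A and B has three elements in {1..k+2} and meets {1..3}, but this only
        bounds a family by about 3 (ln 2)^2 / 2 N > N/2. If the members of A avoiding 1 even have four elements in {1..k+3}, then A
        is small; otherwise a member of A with a sparse trace forces two elements of {1..4} on every
        member of B.\<close>
      show ?thesis
      proof (cases "\<forall>F\<in>A. 1 \<notin> F \<longrightarrow> 4 \<le> card (F \<inter> {1..k + 3})")
        case True
        define A' where "A' = {F \<in> A. 1 \<notin> F}"
        have A': "A' \<subseteq> ksets {1..n} k" "\<And>F. F \<in> A' \<Longrightarrow> 3 + 1 \<le> card (F \<inter> {1..k + 3})"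
          using sub True by (auto simp: A'_def)
        have cA: "card A = card A' + card {F \<in> A. 1 \<in> F}"
          using card_split_mem[OF fin(1), of 1] by (simp add: A'_def card_link)
        have cA1: "card {F \<in> A. 1 \<in> F} \<le> W 2"
          using sk s2 manyA by (intro contains[OF sub(1)]) auto
        \<comment> \<open>Members avoiding \<open>1\<close> are covered by the points
          \<open>2\<close> and \<open>3\<close>, at most \<open>W 3\<close> for each; 6 is
          \<open>fact 3\<close> and 343/1000 is the cube of 7/10.\<close>
        have cA': "6 * real (card A') \<le> 2 * (343 / 1000 * N)"
        proof (cases "A' = {}")
          case False
          then obtain F' where "F' \<in> A'" by auto
          then have "3 + 1 \<le> k" using A'(2)[of F'] cardk[of F' "{1..k + 3}"] by (auto simp: A'_def)
          then have k4: "3 < k" by simp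
          have "card A' \<le> card {2..3 :: nat} * W 3"
          proof (rule card_le_if_meets)
            show "finite A'" using fin by (simp add: A'_def)
            fix i assume "i \<in> {2..3 :: nat}"
            then show "card {G \<in> A'. i \<in> G} \<le> W 3" using A'(2) k4 by (intro contains[OF A'(1)]) auto
          next
            fix G assume "G \<in> A'"
            then have "G \<inter> {1..3} \<noteq> {}" "1 \<notin> G" using meet[of G] s2 by (auto simp: A'_def)
            then obtain y where y: "y \<in> G" "1 \<le> y" "y \<le> 3" by auto
            then have "y \<noteq> 1" using \<open>1 \<notin> G\<close> by metis
            then have "y \<in> {2..3}" using y by auto
            then show "G \<inter> {2..3} \<noteq> {}" using y by blast
          qed simp
          then have "real (card A') \<le> 2 * real (W 3)" by simp
          moreover have "6 * real (W 3) \<le> 343 / 1000 * N"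
            using Wb[OF k4] by (simp add: fact_numeral power3_eq_cube)
          ultimately show ?thesis by linarith
        qed (simp add: N0)
        have "real (card A) \<le> real (card A') + real (W 2)" using cA cA1 by linarith
        then have "2 * real (card A) \<le> N" using cA' W2 N0 by linarith
        then show ?thesis unfolding N_def by linarith
      next
        case False
        then obtain F1 where F1: "F1 \<in> A" "1 \<notin> F1" "card (F1 \<inter> {1..k + 3}) \<le> 3" by force
        have "card B \<le> 6 * k * ((n - 3) choose (k - 3))"
        proof (rule card_two_of_four_le[OF k3 n sub(2)])
          fix G assume G: "G \<in> B"
          show "2 \<le> card (G \<inter> {1..4})" by (rule cross_two_of_four[OF sh sub ci k3 F1 G])
          show "3 \<le> card (G \<inter> {1..k + 2})" using many[OF G] s2 by simp
        qed
        then show ?thesis using two_of_four_count_le[OF k3 n h] by linarith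
      qed
    qed
  qed
qed simp

subsection \<open>Families that are not stars\<close>

text \<open>Not a star. The empty family does not count as \<open>nontrivial\<close>.\<close>

definition nontrivial :: "'a set set \<Rightarrow> bool" where
  "nontrivial A \<longleftrightarrow> (\<forall>x. \<exists>F\<in>A. x \<notin> F)"

text \<open>A shift adds no point other than \<open>i\<close> to a set, so a new common point must
  be \<open>i\<close>, and each member had \<open>i\<close> already or acquired it in exchange for
  \<open>j\<close>.\<close>

lemma shift_trivial_imp_cover:
  assumes "nontrivial A" "\<And>F. F \<in> shift i j A \<Longrightarrow> x \<in> F"
  shows "x = i" "\<And>F. F \<in> A \<Longrightarrow> i \<in> F \<or> j \<in> F"
proof -
  have im: "F \<in> shift i j A \<or> (j \<in> F \<and> insert i (F - {j}) \<in> shift i j A)" if "F \<in> A" for F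
  proof -
    have "shift_set i j A F \<in> shift i j A" using that by (simp add: shift_def)
    then show ?thesis unfolding shift_set_def by (auto split: if_splits)
  qed
  show "x = i"
  proof (rule ccontr)
    assume "x \<noteq> i"
    then have "x \<in> F" if "F \<in> A" for F using im[OF that] assms(2) by blast
    then show False using assms(1) by (auto simp: nontrivial_def)
  qed
  then show "i \<in> F \<or> j \<in> F" if "F \<in> A" for F using im[OF that] assms(2) by blast
qed

lemma cross_intersecting_big_star:
  assumes X: "finite X" "i \<in> X" and k: "0 < k"
    and big: "(card X - 1) choose (k - 1) < card P + ((card X - 1 - k) choose (k - 1))"
    and P: "P \<subseteq> ksets X k" "\<And>F. F \<in> P \<Longrightarrow> i \<in> F"
    and Q: "Q \<subseteq> ksets X k" "cross_intersecting P Q" "G \<in> Q"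
  shows "i \<in> G"
proof (rule ccontr)
  assume "i \<notin> G"
  have "card P + ((card X - 1 - k) choose (k - 1)) \<le> (card X - 1) choose (k - 1)"
  proof (rule star_meeting_bound[OF X])
    show "P \<subseteq> ksets X (Suc (k - 1))" using P(1) k by simp
    show "G \<in> ksets X k" using Q by auto
  qed (use P(2) Q cross_intersectingD \<open>i \<notin> G\<close> in blast)+
  then show False using big by simp
qed

text \<open>Non-triviality stands in for disjointness, which a shift can destroy. A violating pair
  of least element sum is either shifted or covered by two points.\<close>

lemma nontrivial_cross_intersecting_bound:
  assumes k: "2 \<le> k" and n: "2 * k < n"
    and h: "real k * (real k - 1) \<le> ln 2 * (real n - 2 * real k)"
    and A0: "A\<^sub>0 \<subseteq> ksets {1..n} k" "nontrivial A\<^sub>0" and B0: "B\<^sub>0 \<subseteq> ksets {1..n} k" "nontrivial B\<^sub>0"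
    and ci0: "cross_intersecting A\<^sub>0 B\<^sub>0"
  shows "2 * card A\<^sub>0 \<le> (n - 1) choose (k - 1) \<or> 2 * card B\<^sub>0 \<le> (n - 1) choose (k - 1)"
proof (rule ccontr)
  define N where "N = (n - 1) choose (k - 1)"
  define M where "M = (n - k - 1) choose (k - 1)"
  assume "\<not> ?thesis"
  then have big0: "N < 2 * card A\<^sub>0" "N < 2 * card B\<^sub>0" by (auto simp: N_def)
  have NM: "N + 2 \<le> 2 * M" using binomial_more_than_half[OF k n h] by (simp add: N_def M_def)
  define X where "X = {1..n}"
  have X: "finite X" "card X = n" by (auto simp: X_def)
  define W where "W = (\<lambda>P :: nat set set. \<Sum>F\<in>P. sum (\<lambda>x. x) F)"
  define C where "C = (\<lambda>(A, B). A \<subseteq> ksets X k \<and> B \<subseteq> ksets X k \<and> cross_intersecting A B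
     \<and> N < 2 * card A \<and> N < 2 * card B \<and> nontrivial A \<and> nontrivial B)"
  have "C (A\<^sub>0, B\<^sub>0)" using A0 B0 ci0 big0 by (simp add: C_def X_def)
  then obtain A B where AB: "C (A, B)" and least: "\<And>R S. C (R, S) \<Longrightarrow> W A + W B \<le> W R + W S"
    using ex_has_least_nat[of C _ "\<lambda>(R, S). W R + W S"] by force
  have sub: "A \<subseteq> ksets X k" "B \<subseteq> ksets X k" and ci: "cross_intersecting A B"
    and big: "N < 2 * card A" "N < 2 * card B" and nt: "nontrivial A" "nontrivial B"
    using AB by (auto simp: C_def)
  have fin: "finite A" "finite B" "\<And>F. F \<in> A \<Longrightarrow> finite F" "\<And>F. F \<in> B \<Longrightarrow> finite F"
    using sub finite_ksets[OF X(1)] ksets_finite_mem[OF X(1)] by (auto intro: finite_subset)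
  have no_cover: False
    if "i \<in> X" "j \<in> X" "i \<noteq> j" "\<And>F. F \<in> A \<union> B \<Longrightarrow> i \<in> F \<or> j \<in> F" for i j
  proof -
    have "card A + card B + 2 * M \<le> 2 * N + 2"
      using two_cover_bound[OF X(1) _ k sub ci that] nt n X(2) by (auto simp: nontrivial_def N_def M_def)
    then show False using big NM by linarith
  qed
  have star: "i \<in> G"
    if "P \<subseteq> ksets X k" "N < 2 * card P" "\<And>F. F \<in> P \<Longrightarrow> i \<in> F"
      "Q \<subseteq> ksets X k" "cross_intersecting P Q" "i \<in> X" "G \<in> Q" for P Q i G
  proof (rule cross_intersecting_big_star[OF X(1) that(6) _ _ that(1,3-5,7)])
    show "0 < k" using k by simp
    have "card X - 1 - k = n - k - 1" using X by simp
    then show "(card X - 1) choose (k - 1) < card P + ((card X - 1 - k) choose (k - 1))"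
      using NM that(2) X(2) by (simp add: N_def M_def)
  qed
  \<comment> \<open>If the shift of \<open>P\<close> is a star, its centre is \<open>i\<close>;
    being large, it forces the shift of \<open>Q\<close> into the star at \<open>i\<close> as well.
    Undoing the shift leaves both families covered by \<open>i\<close> and \<open>j\<close>.\<close>
  have cover: "i \<in> F \<or> j \<in> F"
    if PQ: "P \<subseteq> ksets X k" "Q \<subseteq> ksets X k" "cross_intersecting P Q" "nontrivial P" "nontrivial Q"
      "N < 2 * card P" and tr: "\<not> nontrivial (shift i j P)" and i: "i \<in> X" and F: "F \<in> P \<union> Q" for P Q i j F
  proof -
    obtain x where x: "\<And>F. F \<in> shift i j P \<Longrightarrow> x \<in> F" using tr by (auto simp: nontrivial_def)
    have xi: "x = i" and cP: "\<And>F. F \<in> P \<Longrightarrow> i \<in> F \<or> j \<in> F"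
      using shift_trivial_imp_cover[OF PQ(4) x] by blast+
    have sP: "i \<in> F" if "F \<in> shift i j P" for F using x[OF that] xi by simp
    have "i \<in> G" if "G \<in> shift i j Q" for G
      using star[OF shift_subset_ksets[OF X(1) i PQ(1)] _ sP shift_subset_ksets[OF X(1) i PQ(2)]
          cross_intersecting_shift[OF PQ(3)] i that] PQ(6) by (simp add: card_shift)
    then have "i \<in> F \<or> j \<in> F" if "F \<in> Q" for F
      using shift_trivial_imp_cover(2)[OF PQ(5), of i j i] that by blast
    then show ?thesis using cP F by blast
  qed
  have fixed: "shift i j A = A \<and> shift i j B = B" if ij: "i \<in> X" "j \<in> X" "i < j" for i j
  proof (rule ccontr)
    assume ne: "\<not> ?thesis"
    \<comment> \<open>A pair that is not fixed becomes lighter, so it must leave \<open>C\<close>.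
      Of the properties in \<open>C\<close> only non-triviality can be lost, and then
      \<open>cover\<close> applies.\<close>
    have "\<not> C (shift i j A, shift i j B)"
    proof
      assume "C (shift i j A, shift i j B)"
      from least[OF this] have "W A + W B \<le> W (shift i j A) + W (shift i j B)" .
      moreover have "W (shift i j A) \<le> W A" "W (shift i j B) \<le> W B"
        unfolding W_def
        using weight_shift_le[of A "\<lambda>x. x" i j] weight_shift_le[of B "\<lambda>x. x" i j] fin ij by auto
      moreover have "W (shift i j A) < W A \<or> W (shift i j B) < W B"
        unfolding W_def
        using weight_shift_less[of A "\<lambda>x. x" i j] weight_shift_less[of B "\<lambda>x. x" i j] fin ij ne by auto
      ultimately show False by linarith
    qed
    then have "\<not> nontrivial (shift i j A) \<or> \<not> nontrivial (shift i j B)"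
      unfolding C_def using sub ci big ij X(1)
      by (simp add: shift_subset_ksets cross_intersecting_shift card_shift)
    moreover have "cross_intersecting B A" using ci cross_intersecting_commute by blast
    ultimately have "i \<in> F \<or> j \<in> F" if "F \<in> A \<union> B" for F
      using cover[OF sub ci nt big(1) _ ij(1)] cover[OF sub(2,1) _ nt(2,1) big(2) _ ij(1)] that by blast
    then show False using no_cover[OF ij(1,2)] ij(3) by simp
  qed
  have shifted: "shifted R" if R: "R \<subseteq> ksets X k" "\<And>i j. i \<in> X \<Longrightarrow> j \<in> X \<Longrightarrow> i < j \<Longrightarrow> shift i j R = R" for R
    unfolding shifted_def
  proof (intro ballI allI impI)
    fix F j i assume F: "F \<in> R" "j \<in> F" "1 \<le> i \<and> i < j \<and> i \<notin> F"
    have "j \<in> X" using F R(1) by (auto simp: ksets_def)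
    moreover have "i \<in> X" using F calculation by (auto simp: X_def)
    ultimately show "insert i (F - {j}) \<in> R" using shift_fixedD[of i j R F] R(2)[of i j] F by simp
  qed
  have sh: "shifted A" "shifted B" using shifted[OF sub(1)] shifted[OF sub(2)] fixed by blast+
  \<comment> \<open>Lengths of initial segments missed by some member. They are bounded since
    members are non-empty subsets of \<open>{1..n}\<close>; \<open>no_cover\<close> puts 2 in
    \<open>S\<close>, and maximality of \<open>s\<close> supplies \<open>meet\<close>.\<close>
  define S where "S = {t. \<exists>F\<in>A \<union> B. F \<inter> {1..t} = {}}"
  have "S \<subseteq> {..n}"
  proof
    fix t assume "t \<in> S"
    then obtain F where F: "F \<in> A \<union> B" "F \<inter> {1..t} = {}" by (auto simp: S_def)
    have "F \<subseteq> {1..n}" "card F = k" using F sub by (auto simp: X_def ksets_def)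
    have "\<not> n \<le> t"
    proof
      assume "n \<le> t"
      then have "F \<subseteq> {1..t}" using \<open>F \<subseteq> {1..n}\<close> by auto
      then have "F = {}" using F(2) by blast
      then show False using \<open>card F = k\<close> k by simp
    qed
    then show "t \<in> {..n}" by simp
  qed
  then have finS: "finite S" by (rule finite_subset) simp
  have S2: "2 \<in> S"
  proof (rule ccontr)
    assume "2 \<notin> S"
    then have "1 \<in> F \<or> 2 \<in> F" if "F \<in> A \<union> B" for F
    proof -
      have "F \<inter> {1..2} \<noteq> {}" using that \<open>2 \<notin> S\<close> unfolding S_def by blast
      then obtain y where "y \<in> F" "y \<in> {1..2}" by blast
      moreover have "y = 1 \<or> y = 2" using calculation by auto
      ultimately show ?thesis by auto
    qed
    then show False using no_cover[of 1 2] n k by (auto simp: X_def)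
  qed
  define s where "s = Max S"
  have "s \<in> S" "2 \<le> s" unfolding s_def using Max_in[OF finS] Max_ge[OF finS S2] S2 by blast+
  have "s + 1 \<notin> S" unfolding s_def using Max_ge[OF finS, of "Max S + 1"] by linarith
  then have meet: "G \<inter> {1..s + 1} \<noteq> {}" if "G \<in> A \<union> B" for G
    using that unfolding S_def by blast
  have meet': "G \<inter> {1..s + 1} \<noteq> {}" if "G \<in> B \<union> A" for G using meet[of G] that by blast
  obtain F where F: "F \<in> A \<union> B" "F \<inter> {1..s} = {}" using \<open>s \<in> S\<close> by (auto simp: S_def)
  have ci': "cross_intersecting B A" using ci cross_intersecting_commute by blast
  note sub' = sub[unfolded X_def]
  show False
  proof (cases "F \<in> A")
    case True
    show False
      using shifted_missing_bound[OF n h sub' ci sh True F(2) \<open>2 \<le> s\<close> meet] big by (simp add: N_def)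
  next
    case False
    then have "F \<in> B" using F by blast
    then show False
      using shifted_missing_bound[OF n h sub'(2,1) ci' sh(2,1) _ F(2) \<open>2 \<le> s\<close> meet'] big by (simp add: N_def)
  qed
qed

text \<open>If both families exceeded half and one were a star, the other would lie in the same full
  star, which is too small for their disjoint union. So both are \<open>nontrivial\<close> and the
  preceding bound applies.\<close>

lemma disjoint_cross_intersecting_bound:
  assumes k: "2 \<le> k" and n: "2 * k < n"
    and h: "real k * (real k - 1) \<le> ln 2 * (real n - 2 * real k)"
    and sub: "A \<subseteq> ksets {1..n} k" "B \<subseteq> ksets {1..n} k" and ci: "cross_intersecting A B" and dis: "A \<inter> B = {}"
  shows "min (card A) (card B) \<le> ((n - 1) choose (k - 1)) div 2"
proof (rule ccontr)
  define N where "N = (n - 1) choose (k - 1)"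
  assume "\<not> ?thesis"
  then have big: "N < 2 * card A" "N < 2 * card B" by (auto simp: N_def)
  have NM: "N + 2 \<le> 2 * ((n - k - 1) choose (k - 1))"
    using binomial_more_than_half[OF k n h] by (simp add: N_def)
  have fin: "finite A" "finite B" using sub finite_ksets[of "{1..n}"] by (auto intro: finite_subset)
  have nt: "nontrivial P"
    if P: "P \<subseteq> ksets {1..n} k" "N < 2 * card P" and Q: "Q \<subseteq> ksets {1..n} k" "cross_intersecting P Q"
      and PQ: "card (P \<union> Q) > N" for P Q
  proof (rule ccontr)
    assume "\<not> nontrivial P"
    then obtain x where x: "\<And>F. F \<in> P \<Longrightarrow> x \<in> F" by (auto simp: nontrivial_def)
    obtain F where "F \<in> P" using P(2) by fastforce
    then have xn: "x \<in> {1..n}" using x P(1) unfolding ksets_def by blast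
    have xQ: "x \<in> G" if "G \<in> Q" for G
    proof (rule cross_intersecting_big_star[OF _ xn _ _ P(1) x Q that])
      have "card {1..n} - 1 - k = n - k - 1" by simp
      then show "(card {1..n} - 1) choose (k - 1) < card P + ((card {1..n} - 1 - k) choose (k - 1))"
        using NM P(2) by (simp add: N_def)
    qed (use k in auto)
    have "P \<union> Q \<subseteq> {F \<in> ksets {1..n} (card {x} + (k - 1)). {x} \<subseteq> F}"
      using P(1) Q(1) x xQ k by auto
    then have "card (P \<union> Q) \<le> card {F \<in> ksets {1..n} (card {x} + (k - 1)). {x} \<subseteq> F}"
      using finite_ksets[of "{1..n}"] by (intro card_mono) auto
    also have "\<dots> = N" using card_ksets_superset[of "{1..n}" "{x}" "k - 1"] xn by (simp add: N_def)
    finally show False using PQ by simp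
  qed
  have "card (A \<union> B) = card A + card B" using fin dis by (rule card_Un_disjoint)
  then have U: "card (A \<union> B) > N" using big by linarith
  then have U': "card (B \<union> A) > N" by (simp add: Un_commute)
  have "cross_intersecting B A" using ci cross_intersecting_commute by blast
  then have "nontrivial A" "nontrivial B"
    using nt[OF sub(1) big(1) sub(2) ci U] nt[OF sub(2) big(2) sub(1) _ U'] by blast+
  then show False
    using nontrivial_cross_intersecting_bound[OF k n h sub(1) _ sub(2) _ ci] big by (simp add: N_def)
qed

section \<open>Constructions for the lower bounds\<close>

lemma star_split_pair:
  assumes "0 < k" "0 < n"
  shows "\<exists>A B. A \<subseteq> ksets {1..n} k \<and> B \<subseteq> ksets {1..n} k \<and> A \<inter> B = {} \<and> cross_intersecting A B
    \<and> min (card A) (card B) = ((n - 1) choose (k - 1)) div 2"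
proof -
  \<comment> \<open>The full star at \<open>1\<close>, to be halved; any two of its members share
    \<open>1\<close>. The size is written as \<open>card {1} + (k - 1)\<close> to fit
    \<open>card_ksets_superset\<close>.\<close>
  define St where "St = {F \<in> ksets {1..n} (card {1 :: nat} + (k - 1)). {1} \<subseteq> F}"
  have cSt: "card St = (n - 1) choose (k - 1)"
    unfolding St_def using assms card_ksets_superset[of "{1..n}" "{1}" "k - 1"] by simp
  have St: "St \<subseteq> ksets {1..n} k" "\<And>F. F \<in> St \<Longrightarrow> 1 \<in> F" using assms by (auto simp: St_def)
  obtain A where A: "A \<subseteq> St" "card A = ((n - 1) choose (k - 1)) div 2" "finite A"
    using obtain_subset_with_card_n[of "((n - 1) choose (k - 1)) div 2" St] cSt by auto
  have "card (St - A) = card St - card A" using A by (intro card_Diff_subset) auto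
  then have "min (card A) (card (St - A)) = ((n - 1) choose (k - 1)) div 2" using A(2) cSt by linarith
  moreover have "cross_intersecting A (St - A)"
    using St(2) A(1) unfolding cross_intersecting_def by blast
  ultimately show ?thesis using A(1) St(1) by (intro exI[of _ A] exI[of _ "St - A"]) auto
qed

text \<open>At most \<open>(n - k) choose (k - 1)\<close> sets through \<open>1\<close> miss
  \<open>D\<close>, so \<open>h\<close> leaves more than half of the star meeting \<open>D\<close>.
  Those in \<open>A\<close> then meet every superset of \<open>D\<close>, which lets
  \<open>B\<close> use sets outside the star.\<close>

lemma large_disjoint_cross_intersecting_pair:
  assumes k: "2 \<le> k" and n: "2 * k < n"
    and h: "2 * ((n - k) choose (k - 1)) < ((n - 1) choose (k - 1))"
  shows "\<exists>A B. A \<subseteq> ksets {1..n} k \<and> B \<subseteq> ksets {1..n} k \<and> A \<inter> B = {} \<and> cross_intersecting A B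
    \<and> ((n - 1) choose (k - 1)) div 2 < min (card A) (card B)"
proof -
  define N where "N = (n - 1) choose (k - 1)"
  define D where "D = {2..k}"
  define St where "St = {F \<in> ksets {1..n} (card {1 :: nat} + (k - 1)). {1} \<subseteq> F}"
  define St' where "St' = {F \<in> St. F \<inter> D \<noteq> {}}"
  have finSt: "finite St" unfolding St_def using finite_ksets[of "{1..n}"] by simp
  have cSt: "card St = N"
    unfolding St_def N_def using n card_ksets_superset[of "{1..n}" "{1}" "k - 1"] by simp
  have St: "St \<subseteq> ksets {1..n} k" "\<And>F. F \<in> St \<Longrightarrow> 1 \<in> F" using k by (auto simp: St_def)
  have "card (St - St') \<le> (n - k) choose (k - 1)"
  proof -
    have "St - St' \<subseteq> {F \<in> ksets ({1..n} - D) (card {1 :: nat} + (k - 1)). {1} \<subseteq> F}"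
      by (auto simp: St_def St'_def ksets_def)
    then have "card (St - St') \<le> card {F \<in> ksets ({1..n} - D) (card {1 :: nat} + (k - 1)). {1} \<subseteq> F}"
      using finite_ksets[of "{1..n} - D"] by (intro card_mono) auto
    also have "\<dots> = (card ({1..n} - D) - 1) choose (k - 1)"
      using card_ksets_superset[of "{1..n} - D" "{1}" "k - 1"] n by (simp add: D_def)
    also have "card ({1..n} - D) = n - (k - 1)"
    proof -
      have "D \<subseteq> {1..n}" using n by (auto simp: D_def)
      then show ?thesis by (simp add: card_Diff_subset D_def)
    qed
    finally show ?thesis using k n by simp
  qed
  moreover have "card (St - St') = card St - card St'"
    using finSt by (intro card_Diff_subset) (auto simp: St'_def)
  ultimately have "N div 2 + 1 \<le> card St'" using h[folded N_def] cSt by linarith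
  then obtain A where A: "A \<subseteq> St'" "card A = N div 2 + 1" "finite A"
    by (rule obtain_subset_with_card_n)
  have ASt: "A \<subseteq> St" using A(1) by (auto simp: St'_def)
  \<comment> \<open>Two extra sets are needed: for even \<open>N\<close>, the rest of the star has
    \<open>N div 2 - 1\<close> members, so one more would only reach \<open>N div 2\<close>.\<close>
  define E where "E = {insert (k + 1) D, insert (k + 2) D}"
  have E: "E \<subseteq> ksets {1..n} k" "\<And>F. F \<in> E \<Longrightarrow> 1 \<notin> F" "\<And>F. F \<in> E \<Longrightarrow> D \<subseteq> F"
    using k n by (auto simp: E_def D_def ksets_def)
  have "k + 1 \<notin> insert (k + 2) D" by (auto simp: D_def)
  then have cE: "card E = 2" unfolding E_def by (metis card_2_iff insertI1)
  define B where "B = (St - A) \<union> E"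
  have "card B = card (St - A) + card E"
    unfolding B_def using finSt St(2) E(2) by (intro card_Un_disjoint) (auto simp: E_def)
  moreover have "card (St - A) = N - card A" using A(3) ASt cSt by (simp add: card_Diff_subset)
  moreover have "card A \<le> N" using card_mono[OF finSt ASt] cSt by simp
  ultimately have "N div 2 < card B" using A(2) cE by linarith
  moreover have "cross_intersecting A B" unfolding cross_intersecting_def
  proof (intro ballI)
    fix F G assume FG: "F \<in> A" "G \<in> B"
    have "F \<inter> D \<noteq> {}" "1 \<in> F" using FG(1) A(1) St(2) by (auto simp: St'_def)
    moreover have "1 \<in> G \<or> D \<subseteq> G" using FG(2) St(2) E(3) by (auto simp: B_def)
    ultimately show "F \<inter> G \<noteq> {}" by blast
  qed
  moreover have "A \<inter> B = {}" using E(2) ASt St(2) by (auto simp: B_def)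
  moreover have "A \<subseteq> ksets {1..n} k" "B \<subseteq> ksets {1..n} k" using ASt St(1) E(1) by (auto simp: B_def)
  ultimately show ?thesis using A(2) by (intro exI[of _ A] exI[of _ B]) (simp add: N_def)
qed

section \<open>Conclusion for both ranges of \<open>n\<close>\<close>

theorem theorem1p4:
  fixes n k :: nat
  defines "c \<equiv> log 2 (exp 1)"
  assumes "k \<ge> 2" and "n > 2 * k"
  shows "(real n \<ge> c * real k ^ 2 + (2 - c) * real k \<longrightarrow>
            f_ci n k = ((n - 1) choose (k - 1)) div 2)
       \<and> (real n \<le> c * real k ^ 2 - 2 * c * real k + 1 \<longrightarrow>
            f_ci n k \<noteq> ((n - 1) choose (k - 1)) div 2)"
proof -
  define N where "N = (n - 1) choose (k - 1)"
  define V where "V = {min (card A) (card B) | A B. A \<subseteq> ksets {1..n} k \<and> B \<subseteq> ksets {1..n} k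
      \<and> A \<inter> B = {} \<and> cross_intersecting A B}"
  have f: "f_ci n k = Max V" by (simp add: f_ci_def V_def ksets_def)
  \<comment> \<open>Finiteness of the set of values gives \<open>Max\<close> its meaning
    here.\<close>
  have fin: "finite V"
  proof (rule finite_subset)
    show "V \<subseteq> {..card (ksets {1..n} k)}"
      unfolding V_def by (auto simp: min_le_iff_disj intro!: card_mono finite_ksets)
  qed simp
  have c: "c = 1 / ln 2" "0 < ln (2 :: real)" by (auto simp: c_def log_def)
  show ?thesis
  proof (intro conjI impI)
    assume "c * real k ^ 2 + (2 - c) * real k \<le> real n"
    \<comment> \<open>Multiplying by \<open>ln 2\<close>, the reciprocal of \<open>c\<close>, brings
      this to the form assumed in the estimates above.\<close>
    then have "c * (real k * (real k - 1)) \<le> real n - 2 * real k"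
      by (simp add: power2_eq_square algebra_simps)
    then have h: "real k * (real k - 1) \<le> ln 2 * (real n - 2 * real k)"
      using c by (simp add: field_simps)
    have "Max V = N div 2"
    proof (rule Max_eqI[OF fin])
      fix y assume "y \<in> V"
      then show "y \<le> N div 2"
        using disjoint_cross_intersecting_bound[OF assms(2,3) h] by (auto simp: V_def N_def)
    next
      have "0 < k" "0 < n" using assms(2,3) by auto
      then obtain A B where "A \<subseteq> ksets {1..n} k" "B \<subseteq> ksets {1..n} k" "A \<inter> B = {}"
        "cross_intersecting A B" "min (card A) (card B) = N div 2"
        unfolding N_def using star_split_pair[of k n] by blast
      then show "N div 2 \<in> V" unfolding V_def mem_Collect_eq by metis
    qed
    then show "f_ci n k = ((n - 1) choose (k - 1)) div 2" by (simp add: f N_def)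
  next
    assume "real n \<le> c * real k ^ 2 - 2 * c * real k + 1"
    then have "real n - 1 \<le> c * (real k * (real k - 2))"
      by (simp add: power2_eq_square algebra_simps)
    then have "ln 2 * (real n - 1) \<le> real k * (real k - 2)"
      using c by (simp add: field_simps)
    then obtain A B where "A \<subseteq> ksets {1..n} k" "B \<subseteq> ksets {1..n} k" "A \<inter> B = {}"
        "cross_intersecting A B" and gt: "N div 2 < min (card A) (card B)"
      unfolding N_def using large_disjoint_cross_intersecting_pair[OF assms(2,3)]
        binomial_less_than_half[OF assms(2,3)] by blast
    then have "min (card A) (card B) \<in> V" unfolding V_def mem_Collect_eq by metis
    then have "N div 2 < Max V" using gt Max_ge[OF fin] by (meson less_le_trans)
    then show "f_ci n k \<noteq> ((n - 1) choose (k - 1)) div 2" by (simp add: f N_def)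
  qed
qed

end
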